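(* For $t,k\in\mathbb N$, there is a finite constant $c_{k,t}>0$ such that, for $\mathcal F$ the space of linear separators on $\mathbb R^k$, and for $P$ with marginal distribution over $\mathcal X=\mathbb R^k$ that is a mixture of $t$ multivariate normal distributions with diagonal covariance matrices of full rank, for all $\epsilon,\delta\in(0,1/2]$, $$\Lambda(\epsilon,\delta)\le c_{k,t}\left(\log\left(\frac1\epsilon\right)\right)^k\log\left(\frac{\log(1/\epsilon)}{\delta}\right).$$
   Context: Let $\mathcal X=\mathbb R^k$ and $\mathcal Y=\{-1,+1\}$. The class of linear separators on $\mathbb R^k$ is the set of classifiers $(x_1,\ldots,x_k)\mapsto\mathrm{sign}(b+\sum_{i=1}^k x_iw_i)$ with $b,w_1,\ldots,w_k\in\mathbb R$, $\sum_i w_i^2=1$, where $\mathrm{sign}(t)=+1$ if $t\ge0$ and $-1$ otherwise, together with the two constant functions $x\mapsto-1$ and $x\mapsto+1$. $P$ is a probability measure on $\mathcal X\times\mathcal Y$ satisfying the realizable-case assumption: there is a target function $f^*\in\mathcal F$ with $\mathbb P(Y=f^*(x)\mid X=x)=1$ for all $x\in\mathcal X$, where $(X,Y)\sim P$. The error rate is $\mathrm{er}(h)=P((x,y):h(x)\ne y)$. For a set $\mathcal H$ of classifiers, $\mathrm{DIS}(\mathcal H)=\{x\in\mathcal X:\exists h,g\in\mathcal H,\ h(x)\ne g(x)\}$. Let $S_\infty=\{(x_1,y_1),(x_2,y_2),\ldots\}$ be i.i.d. with distribution $P$, $S_m=\{(x_1,y_1),\ldots,(x_m,y_m)\}$ ($S_0=\emptyset$),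 and suppose $y_i=f^*(x_i)$ for all $i$ (true with probability 1). For a sample $S$, $\mathrm{VS}_{\mathcal F,S}=\{h\in\mathcal F:\forall(x,y)\in S,\ h(x)=y\}$. Let $N(m;S_m)=\sum_{t'=1}^m\mathbf 1[x_{t'}\in\mathrm{DIS}(\mathrm{VS}_{\mathcal F,S_{t'-1}})]$, the number of labels requested by the CAL active learning algorithm among the first $m$ points. For $n\in\mathbb N$, $M(n;S_\infty)=\min\{m\in\mathbb N:N(m;S_m)=n\}$, or $\infty$ if $\max_mN(m;S_m)<n$. The label complexity of CAL is $$\Lambda(\epsilon,\delta)=\min\Big\{n\in\mathbb N:\mathbb P\Big(\sup_{h\in\mathrm{VS}_{\mathcal F,S_{M(n;S_\infty)}}}\mathrm{er}(h)\le\epsilon\Big)\ge1-\delta\Big\}.$$ *)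

theory Defs
  imports "HOL-Probability.Probability"
begin

section \<open>Classifiers and linear separators\<close>

definition sign_label :: "real \<Rightarrow> int" where
  "sign_label r = (if r \<ge> 0 then 1 else -1)"

definition linear_separators :: "(real ^ 'k \<Rightarrow> int) set" where
  "linear_separators =
     {(\<lambda>x. sign_label (b + (\<Sum>i\<in>UNIV. x $ i * w $ i))) | b w. (\<Sum>i\<in>UNIV. (w $ i)\<^sup>2) = 1}
     \<union> {\<lambda>x. -1, \<lambda>x. 1}"

definition label_space :: "int measure" where
  "label_space = count_space {-1, 1}"

definition DIS :: "('x \<Rightarrow> int) set \<Rightarrow> 'x set" where
  "DIS H = {x. \<exists>h\<in>H. \<exists>g\<in>H. h x \<noteq> g x}"

definition VS :: "('x \<Rightarrow> int) set \<Rightarrow> ('x \<times> int) set \<Rightarrow> ('x \<Rightarrow> int) set" where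
  "VS F A = {h \<in> F. \<forall>(x, y)\<in>A. h x = y}"

definition er :: "('x \<times> int) measure \<Rightarrow> ('x \<Rightarrow> int) \<Rightarrow> real" where
  "er P h = measure P {z \<in> space P. h (fst z) \<noteq> snd z}"


section \<open>The realizable case\<close>

text \<open>
  \<open>\<eta>\<close> is a regular conditional distribution of the label given the instance.
\<close>

definition conditional_label_distribution ::
    "('x::topological_space \<times> int) measure \<Rightarrow> ('x \<Rightarrow> int measure) \<Rightarrow> bool" where
  "conditional_label_distribution P \<eta> \<longleftrightarrow>
     \<eta> \<in> borel \<rightarrow>\<^sub>M prob_algebra label_space \<and>
     (\<forall>A\<in>sets borel. \<forall>B\<in>sets label_space.
        emeasure P (A \<times> B) = (\<integral>\<^sup>+ x\<in>A. emeasure (\<eta> x) B \<partial>(distr P borel fst)))"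

text \<open>
  Conditional distributions are determined only up to a null set of instances, so the requirement
  for all \<open>x\<close> is imposed on some version of the conditional distribution. For Borel measurable
  \<open>f\<close> this says exactly that the label is \<open>f\<close> of the instance almost surely.
\<close>

definition realizable ::
    "('x::topological_space \<Rightarrow> int) set \<Rightarrow> ('x \<times> int) measure \<Rightarrow> bool" where
  "realizable F P \<longleftrightarrow>
     (\<exists>f\<in>F. \<exists>\<eta>. conditional_label_distribution P \<eta> \<and> (\<forall>x. measure (\<eta> x) {f x} = 1))"


section \<open>The label complexity of CAL\<close>

text \<open>
  A sequence \<open>S\<close> of labelled examples is indexed from 0, so \<open>S i\<close> is the example usually
  numbered \<open>i + 1\<close>. The sample consisting of the first \<open>m\<close> examples is represented by its set of
  members, which determines the version space; \<open>m = \<infinity>\<close> gives the whole sequence.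
\<close>

definition sample :: "(nat \<Rightarrow> 'x \<times> int) \<Rightarrow> enat \<Rightarrow> ('x \<times> int) set" where
  "sample S m = {S i | i. enat i < m}"

definition num_labels ::
    "('x \<Rightarrow> int) set \<Rightarrow> (nat \<Rightarrow> 'x \<times> int) \<Rightarrow> nat \<Rightarrow> nat" where
  "num_labels F S m = (\<Sum>i<m. of_bool (fst (S i) \<in> DIS (VS F (sample S (enat i)))))"

text \<open>
  The infimum of the empty set of extended naturals is \<open>\<infinity>\<close>. As \<open>num_labels F S\<close> starts at 0 and
  has increments 0 or 1, the set below is empty iff \<open>num_labels F S m < n\<close> for all \<open>m\<close>.
\<close>

definition label_time ::
    "('x \<Rightarrow> int) set \<Rightarrow> (nat \<Rightarrow> 'x \<times> int) \<Rightarrow> nat \<Rightarrow> enat" where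
  "label_time F S n = Inf (enat ` {m. num_labels F S m = n})"

text \<open>
  The supremum is taken in the extended reals, so that it is meaningful also on the null event
  where the version space is empty. Label budgets are positive; admitting \<open>n = 0\<close> as well
  could only make the label complexity smaller.
\<close>

definition label_complexity ::
    "('x \<Rightarrow> int) set \<Rightarrow> ('x \<times> int) measure \<Rightarrow> real \<Rightarrow> real \<Rightarrow> enat" where
  "label_complexity F P \<epsilon> \<delta> =
     Inf (enat ` {n. n \<ge> 1 \<and>
        measure (\<Pi>\<^sub>M i\<in>(UNIV :: nat set). P)
          {S \<in> space (\<Pi>\<^sub>M i\<in>(UNIV :: nat set). P).
             (SUP h\<in>VS F (sample S (label_time F S n)). ereal (er P h)) \<le> ereal \<epsilon>}
        \<ge> 1 - \<delta>})"


section \<open>Mixtures of multivariate normal distributions\<close>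

definition covariance_matrix :: "real ^ 'k ^ 'k \<Rightarrow> bool" where
  "covariance_matrix C \<longleftrightarrow> transpose C = C \<and> (\<forall>v. 0 \<le> v \<bullet> (C *v v))"

definition diagonal_matrix :: "real ^ 'k ^ 'k \<Rightarrow> bool" where
  "diagonal_matrix C \<longleftrightarrow> (\<forall>i j. i \<noteq> j \<longrightarrow> C $ i $ j = 0)"

text \<open>Only meaningful for covariance matrices of full rank.\<close>

definition multivariate_normal :: "real ^ 'k \<Rightarrow> real ^ 'k ^ 'k \<Rightarrow> (real ^ 'k) measure" where
  "multivariate_normal \<mu> C =
     density lborel (\<lambda>x. ennreal
       (exp (- ((x - \<mu>) \<bullet> (matrix_inv C *v (x - \<mu>))) / 2) / sqrt ((2 * pi) ^ CARD('k) * det C)))"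

definition mixture_of :: "nat \<Rightarrow> 'x measure set \<Rightarrow> 'x::topological_space measure \<Rightarrow> bool" where
  "mixture_of t K D \<longleftrightarrow>
     sets D = sets borel \<and>
     (\<exists>p \<nu>. (\<forall>j<t. (0::real) \<le> p j \<and> \<nu> j \<in> K) \<and> (\<Sum>j<t. p j) = 1 \<and>
        (\<forall>A\<in>sets borel. emeasure D A = (\<Sum>j<t. ennreal (p j) * emeasure (\<nu> j) A)))"

definition diagonal_normals :: "(real ^ 'k) measure set" where
  "diagonal_normals =
     {multivariate_normal \<mu> C | \<mu> C.
        covariance_matrix C \<and> diagonal_matrix C \<and> rank C = CARD('k)}"

end

theory Submission
  imports Defs "HOL-Real_Asymp.Real_Asymp"
begin

text \<open>
  Let the sample be labelled by a separator with normal vector \<open>w\<close>. For each normal component of the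
  mixture, an affine change of coordinates makes the component standard normal and \<open>w\<close> a coordinate
  axis. If \<open>x\<close> lies in the region of disagreement, then one of the \<open>2\<^sup>k\<close> closed orthants at \<open>x\<close> contains
  no sample point with the label of \<open>x\<close>. The mass of the part of an orthant with the label of \<open>x\<close> is a
  product of one-dimensional masses \<open>U\<close> that satisfy \<open>P(U \<le> \<tau>) \<le> 4\<tau>\<close> for every choice of the
  parameters. Summing over the sample sizes below \<open>2\<^sup>N\<close>, the expected number of requests is
  \<open>O(N\<^sup>k)\<close>, with a constant that depends only on \<open>k\<close> and the number of components.

  For the confidence, the sample of size \<open>q 2\<^sup>i\<close> is split into \<open>q\<close> independent blocks of size \<open>2\<^sup>i\<close>. As
  the region of disagreement shrinks with the sample, its mass exceeds twice the expectation for size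
  \<open>2\<^sup>i\<close> with probability at most \<open>2\<^sup>-\<^sup>q\<close>, and by a Chernoff bound the number of requests at times
  between \<open>q 2\<^sup>i\<close> and \<open>q 2\<^sup>i\<^sup>+\<^sup>1\<close> is then of order \<open>q\<close> times the corresponding expectation, up to an
  additive \<open>q\<close>. The error of every separator in the version space is at most the mass of the region of
  disagreement, which is below \<open>\<epsilon>\<close> for some \<open>N = O(ln (1 / \<epsilon>))\<close>; and \<open>q = O(ln (N / \<delta>))\<close> suffices.
\<close>

section \<open>From the expected to the actual disagreement mass\<close>

text \<open>Markov's inequality for the number of requests would cost a factor
  \<open>1 / \<delta>\<close>. Blocks and the Chernoff bound replace it by a logarithm, and the
  union bound over about \<open>2 * N\<close> events is what puts \<open>ln (1 / \<epsilon>)\<close>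
  inside that logarithm. The power k arises because the mean of min(2^N, 1 / (U_1 ... U_k)) is at
  most of order N^k for independent U_i with linear tails. The truncation at 2^N couples the
  coordinates, so a weight that is a product over the coordinates has to dominate the truncated
  function before it can be integrated. Two things keep the constant free of the parameters of the
  mixture. The tail bound for U rests on an argument valid for every probability distribution on the
  line. A component of weight a sees orthants of mass at least a times its own mass u, and the sum
  of a (1 - a u)^m over m is at most 1 / u, so light components do no harm. The orthants at x are
  taken in the coordinates of the component from which x is drawn, although the sample comes from
  the whole mixture.\<close>

text \<open>\<open>R A\<close> plays the role of the set of examples whose labels are requested after the sample \<open>A\<close>.\<close>

locale disagreement_region = prob_space P for P :: "'z measure" +
  fixes R :: "'z set \<Rightarrow> 'z set"
  assumes region_antimono: "A \<subseteq> B \<Longrightarrow> R B \<subseteq> R A"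
    and region_measurable: "finite J \<Longrightarrow>
      {p \<in> space (PiM J (\<lambda>_. P) \<Otimes>\<^sub>M P). snd p \<in> R (fst p ` J)} \<in> sets (PiM (J :: nat set) (\<lambda>_. P) \<Otimes>\<^sub>M P)"
begin

abbreviation \<Omega> where "\<Omega> \<equiv> PiM (UNIV :: nat set) (\<lambda>_. P)"

sublocale seq: product_prob_space "\<lambda>_ :: nat. P" UNIV ..

text \<open>Indexed by a set of positions rather than by a length, so that one notion serves initial
  segments and the blocks inside them.\<close>

definition mass :: "nat set \<Rightarrow> (nat \<Rightarrow> 'z) \<Rightarrow> real" where
  "mass J S = prob {z \<in> space P. z \<in> R (S ` J)}"

lemma mass_nonneg: "0 \<le> mass J S"
  by (simp add: mass_def)

lemma mass_restrict [simp]: "mass J (restrict S J) = mass J S"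
  by (simp add: mass_def cong: image_cong)

lemma region_slice [measurable]:
  fixes J :: "nat set"
  assumes "finite J" "S \<in> space (PiM J (\<lambda>_. P))"
  shows "{z \<in> space P. z \<in> R (S ` J)} \<in> sets P"
proof -
  have "Pair S -` {p \<in> space (PiM J (\<lambda>_. P) \<Otimes>\<^sub>M P). snd p \<in> R (fst p ` J)} \<in> sets P"
    by (rule sets_Pair1[OF region_measurable[OF assms(1)]])
  also have "Pair S -` {p \<in> space (PiM J (\<lambda>_. P) \<Otimes>\<^sub>M P). snd p \<in> R (fst p ` J)}
      = {z \<in> space P. z \<in> R (S ` J)}"
    using assms by (auto simp: space_pair_measure)
  finally show ?thesis .
qed

lemma region_slice_UNIV:
  assumes "finite J" "S \<in> space \<Omega>"
  shows "{z \<in> space P. z \<in> R (S ` J)} \<in> sets P"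
proof -
  have "restrict S J \<in> space (PiM J (\<lambda>_. P))"
    using assms by (auto simp: space_PiM)
  from region_slice[OF assms(1) this] show ?thesis by (simp cong: image_cong)
qed

lemma mass_measurable:
  assumes "finite J"
  shows "mass J \<in> borel_measurable (PiM J (\<lambda>_. P))"
proof -
  let ?Q = "{p \<in> space (PiM J (\<lambda>_. P) \<Otimes>\<^sub>M P). snd p \<in> R (fst p ` J)}"
  have "(\<lambda>S. measure P (Pair S -` ?Q)) \<in> borel_measurable (PiM J (\<lambda>_. P))"
    unfolding measure_def
    by (intro borel_measurable_enn2real measurable_emeasure_Pair region_measurable assms)
  moreover have "mass J S = measure P (Pair S -` ?Q)" if "S \<in> space (PiM J (\<lambda>_. P))" for S
    unfolding mass_def using that
    by (intro arg_cong[where f = "measure P"]) (auto simp: space_pair_measure)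
  ultimately show ?thesis
    by (simp cong: measurable_cong)
qed

lemma mass_measurable_UNIV [measurable]:
  assumes "finite J"
  shows "mass J \<in> borel_measurable \<Omega>"
proof -
  have "(\<lambda>S. mass J (restrict S J)) \<in> borel_measurable \<Omega>"
    by (rule measurable_compose[OF measurable_restrict_subset mass_measurable[OF assms]]) simp
  then show ?thesis by simp
qed

lemma mass_antimono:
  assumes "finite J" "J' \<subseteq> J" "S \<in> space \<Omega>"
  shows "mass J S \<le> mass J' S"
  unfolding mass_def
proof (rule finite_measure_mono)
  show "{z \<in> space P. z \<in> R (S ` J)} \<subseteq> {z \<in> space P. z \<in> R (S ` J')}"
    using region_antimono[of "S ` J'" "S ` J"] assms(2) by auto
  show "{z \<in> space P. z \<in> R (S ` J')} \<in> events"
    using region_slice_UNIV[of J' S] assms finite_subset by auto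
qed

lemma mass_markov:
  assumes "finite J" and le: "(\<integral>\<^sup>+S. mass J S \<partial>\<Omega>) \<le> ennreal p" and "0 \<le> p"
  shows "measure \<Omega> {S \<in> space \<Omega>. mass J S > 2 * p} \<le> 1 / 2"
\<comment> \<open>The division in Markov's inequality needs \<open>p > 0\<close>. For
  \<open>p = 0\<close> the mass vanishes almost surely, which the strict inequality in the event
  covers.\<close>
proof (cases "p = 0")
  case True
  with le have "(\<integral>\<^sup>+S. mass J S \<partial>\<Omega>) = 0" by simp
  then have "AE S in \<Omega>. ennreal (mass J S) = 0"
    using assms(1) by (subst (asm) nn_integral_0_iff_AE) auto
  then have "AE S in \<Omega>. \<not> mass J S > 2 * p"
    by eventually_elim (auto simp: True mass_def)
  then have "emeasure \<Omega> {S \<in> space \<Omega>. mass J S > 2 * p} = 0"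
    using assms(1) by (subst (asm) AE_iff_measurable[OF _ refl]) auto
  then show ?thesis by (simp add: measure_def)
next
  case False
  then have p: "p > 0" using assms by simp
  have "emeasure \<Omega> {S \<in> space \<Omega>. mass J S > 2 * p} \<le> emeasure \<Omega> {S \<in> space \<Omega>. 1 \<le> ennreal (1 / (2 * p)) * mass J S}"
    using assms(1) p
    by (intro emeasure_mono) (auto simp: ennreal_mult[symmetric] mass_nonneg field_simps)
  also have "{S \<in> space \<Omega>. 1 \<le> ennreal (1 / (2 * p)) * mass J S} = {S \<in> space \<Omega>. 1 \<le> ennreal (1 / (2 * p)) * mass J S} \<inter> space \<Omega>"
    by auto
  also have "emeasure \<Omega> \<dots> \<le> ennreal (1 / (2 * p)) * (\<integral>\<^sup>+S. ennreal (mass J S) * indicator (space \<Omega>) S \<partial>\<Omega>)"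
    using assms(1) by (intro order.trans[OF _ nn_integral_Markov_inequality]) auto
  also have "\<dots> \<le> ennreal (1 / (2 * p)) * ennreal p"
    using le by (intro mult_left_mono) (auto cong: nn_integral_cong simp: indicator_def)
  also have "\<dots> = ennreal (1 / 2)"
    using p by (subst ennreal_mult[symmetric]) (auto simp: field_simps)
  finally have "ennreal (measure \<Omega> {S \<in> space \<Omega>. mass J S > 2 * p}) \<le> ennreal (1/2)"
    by (simp only: seq.emeasure_eq_measure)
  then show ?thesis by (subst (asm) ennreal_le_iff) auto
qed

text \<open>The mass is antitone in the sample, so it exceeds twice its expected value for a single
  block only if it does so for each of several independent blocks.\<close>

lemma blocks_all_bad:
  assumes fin: "\<And>r. r < q \<Longrightarrow> finite (J r)" and disj: "disjoint_family_on J {..<q}" and "0 < q"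
    and le: "\<And>r. r < q \<Longrightarrow> (\<integral>\<^sup>+S. mass (J r) S \<partial>\<Omega>) \<le> ennreal p" and "0 \<le> p"
  shows "measure \<Omega> {S \<in> space \<Omega>. \<forall>r<q. mass (J r) S > 2 * p} \<le> (1 / 2) ^ q"
proof -
  let ?A = "\<lambda>r. {S \<in> space (PiM (J r) (\<lambda>_. P)). mass (J r) S > 2 * p}"
  let ?X = "\<lambda>r S. restrict (\<lambda>i. S i) (J r)"
  \<comment> \<open>Under a product measure the coordinates are independent, and functions of
    disjoint sets of coordinates inherit this.\<close>
  have "seq.indep_vars (\<lambda>_. P) (\<lambda>i S. S i) UNIV"
    by (subst seq.indep_vars_iff_distr_eq_PiM) (auto simp: seq.PiM_component restrict_UNIV distr_id2)
  then have ind: "seq.indep_vars (\<lambda>r. PiM (J r) (\<lambda>_. P)) ?X {..<q}"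
    by (rule seq.indep_vars_restrict) (use disj in auto)
  have A: "?A r \<in> sets (PiM (J r) (\<lambda>_. P))" if "r < q" for r
    using mass_measurable[OF fin[OF that]] by measurable
  have pre: "?X r -` ?A r \<inter> space \<Omega> = {S \<in> space \<Omega>. mass (J r) S > 2 * p}" for r
    by (auto simp: space_PiM)
  have "{S \<in> space \<Omega>. \<forall>r<q. mass (J r) S > 2 * p} = (\<Inter>r\<in>{..<q}. ?X r -` ?A r \<inter> space \<Omega>)"
    unfolding pre using \<open>0 < q\<close> by auto
  also have "measure \<Omega> \<dots> = (\<Prod>r<q. measure \<Omega> (?X r -` ?A r \<inter> space \<Omega>))"
    using \<open>0 < q\<close> A by (intro seq.indep_varsD_finite[OF ind]) auto
  also have "\<dots> \<le> (\<Prod>r<q. 1 / 2)"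
    unfolding pre by (intro prod_mono conjI mass_markov fin le assms measure_nonneg) auto
  finally show ?thesis by simp
qed

section \<open>Requests after a fixed sample\<close>

lemma hits_measurable [measurable]:
  assumes "finite J"
  shows "Measurable.pred \<Omega> (\<lambda>S. S i \<in> R (S ` J))"
proof -
  let ?Q = "{p \<in> space (PiM J (\<lambda>_. P) \<Otimes>\<^sub>M P). snd p \<in> R (fst p ` J)}"
  have m: "(\<lambda>S. (restrict S J, S i)) \<in> \<Omega> \<rightarrow>\<^sub>M PiM J (\<lambda>_. P) \<Otimes>\<^sub>M P"
    by (intro measurable_Pair measurable_restrict_subset) auto
  have "(\<lambda>S. (restrict S J, S i)) -` ?Q \<inter> space \<Omega> \<in> sets \<Omega>"
    by (rule measurable_sets[OF m region_measurable[OF assms]])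
  also have "(\<lambda>S. (restrict S J, S i)) -` ?Q \<inter> space \<Omega> = {S \<in> space \<Omega>. S i \<in> R (S ` J)}"
    using measurable_space[OF m] by (auto cong: image_cong)
  finally show ?thesis by (simp add: pred_def)
qed

text \<open>The product is 2 to the number of hits. With the positions in \<open>J\<close> fixed,
  the region is a fixed set, so the hits at the positions in \<open>K\<close> are independent and
  each factor has mean \<open>1 + mass J S\<close>, which is at most \<open>exp \<tau>\<close> on
  the event in the indicator.\<close>

lemma exp_hits_le:
  fixes \<tau> :: real
  assumes J: "finite J" and K: "finite K" and JK: "J \<inter> K = {}" and "0 \<le> \<tau>"
  shows "(\<integral>\<^sup>+S. indicator {S. mass J S \<le> \<tau>} S *
      (\<Prod>j\<in>K. 1 + of_bool (S j \<in> R (S ` J))) \<partial>\<Omega>) \<le> ennreal (exp (card K * \<tau>))"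
proof -
  let ?g = "\<lambda>S. indicator {S. mass J S \<le> \<tau>} S * (\<Prod>j\<in>K. 1 + of_bool (S j \<in> R (S ` J))) :: ennreal"
  let ?PJ = "PiM J (\<lambda>_. P)" let ?PK = "PiM K (\<lambda>_. P)" let ?PU = "PiM (J \<union> K) (\<lambda>_. P)"
  have hit: "Measurable.pred ?PU (\<lambda>S. S j \<in> R (S ` J))" if "j \<in> K" for j
  proof -
    let ?Q = "{p \<in> space (PiM J (\<lambda>_. P) \<Otimes>\<^sub>M P). snd p \<in> R (fst p ` J)}"
    have m: "(\<lambda>S. (restrict S J, S j)) \<in> ?PU \<rightarrow>\<^sub>M PiM J (\<lambda>_. P) \<Otimes>\<^sub>M P"
      using that by (intro measurable_Pair measurable_restrict_subset) auto
    have "(\<lambda>S. (restrict S J, S j)) -` ?Q \<inter> space ?PU \<in> sets ?PU"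
      by (rule measurable_sets[OF m region_measurable[OF J]])
    also have "(\<lambda>S. (restrict S J, S j)) -` ?Q \<inter> space ?PU = {S \<in> space ?PU. S j \<in> R (S ` J)}"
      using measurable_space[OF m] by (auto cong: image_cong)
    finally show ?thesis by (simp add: pred_def)
  qed
  have massU: "mass J \<in> borel_measurable ?PU"
  proof -
    have "(\<lambda>S. mass J (restrict S J)) \<in> borel_measurable ?PU"
      by (rule measurable_compose[OF measurable_restrict_subset mass_measurable[OF J]]) simp
    then show ?thesis by simp
  qed
  have gU: "?g \<in> borel_measurable ?PU"
    using hit massU by measurable
  have greq: "?g (restrict S (J \<union> K)) = ?g S" for S
  proof -
    have "restrict S (J \<union> K) ` J = S ` J" by auto
    moreover have "mass J (restrict S (J \<union> K)) = mass J S"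
      unfolding mass_def calculation ..
    ultimately show ?thesis by (simp add: indicator_def)
  qed
  have "(\<integral>\<^sup>+S. ?g S \<partial>\<Omega>) = (\<integral>\<^sup>+S. ?g (restrict S (J \<union> K)) \<partial>\<Omega>)"
    by (simp only: greq)
  also have "\<dots> = (\<integral>\<^sup>+S. ?g S \<partial>distr \<Omega> ?PU (\<lambda>S. restrict S (J \<union> K)))"
    using gU by (subst nn_integral_distr) (auto intro!: measurable_restrict_subset)
  also have "\<dots> = (\<integral>\<^sup>+S. ?g S \<partial>?PU)"
    using J K by (subst seq.distr_PiM_restrict_finite) auto
  \<comment> \<open>Fubini: the positions in \<open>K\<close> are integrated first, with those in
    \<open>J\<close> held fixed.\<close>
  also have "\<dots> = (\<integral>\<^sup>+x. (\<integral>\<^sup>+y. ?g (merge J K (x, y)) \<partial>?PK) \<partial>?PJ)"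
    by (rule seq.product_nn_integral_fold[OF JK J K gU])
  also have "\<dots> \<le> (\<integral>\<^sup>+x. ennreal (exp (card K * \<tau>)) \<partial>?PJ)"
  proof (rule nn_integral_mono)
    fix x assume x: "x \<in> space ?PJ"
    let ?Rx = "{z \<in> space P. z \<in> R (x ` J)}"
    have Rx[measurable]: "?Rx \<in> sets P" by (rule region_slice[OF J x])
    have im: "merge J K (x, y) ` J = x ` J" for y
      by (auto simp: merge_def)
    have "?g (merge J K (x, y)) = indicator {S. mass J S \<le> \<tau>} x * (\<Prod>j\<in>K. 1 + indicator ?Rx (y j))"
      if "y \<in> space ?PK" for y
    proof -
      have "mass J (merge J K (x, y)) = mass J x" unfolding mass_def im ..
      moreover have "(\<Prod>j\<in>K. 1 + of_bool (merge J K (x, y) j \<in> R (merge J K (x, y) ` J)))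
          = (\<Prod>j\<in>K. 1 + indicator ?Rx (y j) :: ennreal)"
        unfolding im using that JK
        by (intro prod.cong) (auto simp: merge_def indicator_def space_PiM)
      ultimately show ?thesis by (simp add: indicator_def)
    qed
    then have "(\<integral>\<^sup>+y. ?g (merge J K (x, y)) \<partial>?PK)
        = (\<integral>\<^sup>+y. indicator {S. mass J S \<le> \<tau>} x * (\<Prod>j\<in>K. 1 + indicator ?Rx (y j)) \<partial>?PK)"
      by (intro nn_integral_cong) auto
    also have "\<dots> = indicator {S. mass J S \<le> \<tau>} x * (\<integral>\<^sup>+y. (\<Prod>j\<in>K. 1 + indicator ?Rx (y j)) \<partial>?PK)"
      by (intro nn_integral_cmult) measurable
    also have "(\<integral>\<^sup>+y. (\<Prod>j\<in>K. 1 + indicator ?Rx (y j)) \<partial>?PK) = (\<Prod>j\<in>K. \<integral>\<^sup>+z. 1 + indicator ?Rx z \<partial>P)"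
      by (rule seq.product_nn_integral_prod[OF K]) measurable
    also have "(\<integral>\<^sup>+z. 1 + indicator ?Rx z \<partial>P) = ennreal (1 + mass J x)"
      by (subst nn_integral_add) (auto simp: mass_def emeasure_eq_measure ennreal_plus prob_space)
    also have "indicator {S. mass J S \<le> \<tau>} x * (\<Prod>j\<in>K. ennreal (1 + mass J x)) \<le> ennreal (exp (card K * \<tau>))"
    proof (cases "mass J x \<le> \<tau>")
      case True
      have "(1 + mass J x) ^ card K \<le> exp \<tau> ^ card K"
        using True exp_ge_add_one_self[of \<tau>] mass_nonneg[of J x]
        by (intro power_mono; linarith)
      then show ?thesis
        using True by (simp add: exp_of_nat_mult[symmetric] ennreal_power mass_nonneg ennreal_leI del: ennreal_plus)
    qed auto
    finally show "(\<integral>\<^sup>+y. ?g (merge J K (x, y)) \<partial>?PK) \<le> ennreal (exp (card K * \<tau>))" .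
  qed
  also have "\<dots> = ennreal (exp (card K * \<tau>))"
  proof -
    have "emeasure ?PJ (space ?PJ) = 1"
      by (intro prob_space.emeasure_space_1 prob_space_PiM prob_space_axioms)
    then show ?thesis by simp
  qed
  finally show ?thesis .
qed

text \<open>Markov's inequality for 2 to the number of hits, whose mean \<open>exp_hits_le\<close>
  bounds. The part \<open>2 * card K * \<tau>\<close> of the threshold absorbs this mean, and
  \<open>q\<close> remains as the exponent of the bound.\<close>

lemma many_hits:
  fixes \<tau> :: real and q :: nat
  assumes J: "finite J" and K: "finite K" and JK: "J \<inter> K = {}" and "0 \<le> \<tau>"
  shows "measure \<Omega> {S \<in> space \<Omega>. mass J S \<le> \<tau> \<and>
      real (\<Sum>j\<in>K. of_bool (S j \<in> R (S ` J))) \<ge> 2 * card K * \<tau> + q} \<le> (1 / 2) ^ q"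
proof -
  let ?u = "\<lambda>S. indicator {S. mass J S \<le> \<tau>} S * (\<Prod>j\<in>K. 1 + of_bool (S j \<in> R (S ` J))) :: ennreal"
  let ?c = "2 powr (2 * card K * \<tau> + q)"
  let ?A = "{S \<in> space \<Omega>. mass J S \<le> \<tau> \<and>
      real (\<Sum>j\<in>K. of_bool (S j \<in> R (S ` J))) \<ge> 2 * card K * \<tau> + q}"
  have uM[measurable]: "?u \<in> borel_measurable \<Omega>"
    using hits_measurable[OF J] mass_measurable_UNIV[OF J] by measurable
  have c: "?c > 0" by simp
  have pr: "(\<Prod>j\<in>K. 1 + of_bool (Q j)) = (2::ennreal) ^ (\<Sum>j\<in>K. of_bool (Q j))" for Q
    using K by (induction K) (auto simp: one_add_one)
  have "?A \<subseteq> {S \<in> space \<Omega>. 1 \<le> ennreal (1 / ?c) * ?u S} \<inter> space \<Omega>"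
  proof (rule subsetI)
    fix S assume "S \<in> ?A"
    then have SO: "S \<in> space \<Omega>"
      and S: "mass J S \<le> \<tau>" "2 * card K * \<tau> + q \<le> real (\<Sum>j\<in>K. of_bool (S j \<in> R (S ` J)))"
      by auto
    let ?n = "\<Sum>j\<in>K. of_bool (S j \<in> R (S ` J)) :: nat"
    have "?c \<le> 2 powr real ?n" using S(2) by (intro powr_mono) auto
    also have "\<dots> = 2 ^ ?n" by (simp only: powr_realpow zero_less_numeral)
    finally have *: "?c \<le> 2 ^ ?n" .
    have "?u S = ennreal (2 ^ ?n)"
      using S(1) unfolding pr by (simp add: ennreal_power[symmetric] del: ennreal_power)
    also have "ennreal (1 / ?c) * \<dots> = ennreal (2 ^ ?n / ?c)"
      by (subst ennreal_mult[symmetric]) auto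
    also have "\<dots> \<ge> ennreal 1"
      using * c by (intro ennreal_leI) (simp add: field_simps)
    finally show "S \<in> {S \<in> space \<Omega>. 1 \<le> ennreal (1 / ?c) * ?u S} \<inter> space \<Omega>"
      using SO by simp
  qed
  then have "emeasure \<Omega> ?A \<le> emeasure \<Omega> ({S \<in> space \<Omega>. 1 \<le> ennreal (1 / ?c) * ?u S} \<inter> space \<Omega>)"
    by (intro emeasure_mono) auto
  also have "\<dots> \<le> ennreal (1 / ?c) * (\<integral>\<^sup>+S. ?u S * indicator (space \<Omega>) S \<partial>\<Omega>)"
    by (intro order.trans[OF _ nn_integral_Markov_inequality]) auto
  also have "(\<integral>\<^sup>+S. ?u S * indicator (space \<Omega>) S \<partial>\<Omega>) = (\<integral>\<^sup>+S. ?u S \<partial>\<Omega>)"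
    by (intro nn_integral_cong) auto
  also have "ennreal (1 / ?c) * (\<integral>\<^sup>+S. ?u S \<partial>\<Omega>) \<le> ennreal (1 / ?c) * ennreal (exp (card K * \<tau>))"
    using exp_hits_le[OF assms] by (intro mult_left_mono) auto
  also have "\<dots> = ennreal (exp (card K * \<tau>) / ?c)"
    by (subst ennreal_mult[symmetric]) auto
  also have "\<dots> \<le> ennreal ((1 / 2) ^ q)"
  proof (rule ennreal_leI)
    \<comment> \<open>The factor 2 in the threshold is used here: e is at most 2^2.\<close>
    have "exp (card K * \<tau>) \<le> 2 powr (2 * card K * \<tau>)"
    proof -
      have "ln (2::real) \<ge> 1 / 2" using ln2_ge_two_thirds by simp
      then have "(card K * \<tau>) * 1 \<le> (card K * \<tau>) * (2 * ln 2)"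
        using \<open>0 \<le> \<tau>\<close> by (intro mult_left_mono) auto
      then show ?thesis by (simp add: powr_def mult_ac)
    qed
    then have "exp (card K * \<tau>) / ?c \<le> 2 powr (2 * card K * \<tau>) / ?c"
      by (intro divide_right_mono) auto
    also have "\<dots> = (1 / 2) ^ q"
      by (simp add: powr_add powr_realpow power_one_over)
    finally show "exp (card K * \<tau>) / ?c \<le> (1 / 2) ^ q" .
  qed
  finally have "ennreal (measure \<Omega> ?A) \<le> ennreal ((1 / 2) ^ q)"
    by (simp only: seq.emeasure_eq_measure)
  then show ?thesis by (subst (asm) ennreal_le_iff) auto
qed


text \<open>\<open>B\<close> collects the \<open>I + 1\<close> events that all blocks of one size
  are bad and the \<open>I\<close> events of too many hits in a stretch from \<open>N i\<close> to
  \<open>N (Suc i)\<close>, hence \<open>2 * I + 1\<close>. Such a stretch has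
  \<open>q * 2 ^ i\<close> positions, and the mass at its start is at most
  \<open>2 * p (2 ^ i)\<close>; so \<open>many_hits\<close> gives the summand
  \<open>4 * q * 2 ^ i * p (2 ^ i) + q\<close>.\<close>

lemma boosting:
  fixes p :: "nat \<Rightarrow> real" and I q :: nat
  assumes "0 < q" and p: "\<And>m. 0 \<le> p m"
    and mean: "\<And>J. finite J \<Longrightarrow> (\<integral>\<^sup>+S. mass J S \<partial>\<Omega>) \<le> ennreal (p (card J))"
  obtains B where "B \<in> sets \<Omega>" "measure \<Omega> B \<le> (2 * I + 1) * (1 / 2) ^ q"
    "\<And>S. S \<in> space \<Omega> - B \<Longrightarrow> mass {..<q * 2 ^ I} S \<le> 2 * p (2 ^ I)"
    "\<And>S. S \<in> space \<Omega> - B \<Longrightarrow> real (\<Sum>j<q * 2 ^ I. of_bool (S j \<in> R (S ` {..<j})))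
      \<le> q + (\<Sum>i<I. 4 * q * 2 ^ i * p (2 ^ i) + q)"
proof -
  define N where "N i = q * 2 ^ i" for i :: nat
  define blk where "blk i r = {r * 2 ^ i..<Suc r * 2 ^ i}" for i r :: nat
  define B1 where "B1 i = {S \<in> space \<Omega>. \<forall>r<q. mass (blk i r) S > 2 * p (2 ^ i)}" for i
  define B2 where "B2 i = {S \<in> space \<Omega>. mass {..<N i} S \<le> 2 * p (2 ^ i) \<and>
      real (\<Sum>j\<in>{N i..<N (Suc i)}. of_bool (S j \<in> R (S ` {..<N i})))
        \<ge> 2 * card {N i..<N (Suc i)} * (2 * p (2 ^ i)) + q}" for i
  have fin: "finite (blk i r)" for i r by (simp add: blk_def)
  have cardN: "card {N i..<N (Suc i)} = q * 2 ^ i" for i by (simp add: N_def)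
  have B1s[measurable]: "B1 i \<in> sets \<Omega>" for i
    unfolding B1_def using fin[of i] by measurable
  have B2s[measurable]: "B2 i \<in> sets \<Omega>" for i
    unfolding B2_def by measurable
  have B1m: "measure \<Omega> (B1 i) \<le> (1 / 2) ^ q" for i
    unfolding B1_def
  proof (rule blocks_all_bad[OF fin _ \<open>0 < q\<close> _ p])
    have "m = n" if "x \<in> blk i m" "x \<in> blk i n" for x m n
    proof -
      have "x div 2 ^ i = m" "x div 2 ^ i = n"
        using that by (auto simp: blk_def intro!: div_nat_eqI simp: mult.commute)
      then show ?thesis by simp
    qed
    then show "disjoint_family_on (blk i) {..<q}"
      by (auto simp: disjoint_family_on_def)
    show "(\<integral>\<^sup>+S. mass (blk i r) S \<partial>\<Omega>) \<le> ennreal (p (2 ^ i))" for r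
      using mean[OF fin, of i r] by (simp add: blk_def)
  qed
  have B2m: "measure \<Omega> (B2 i) \<le> (1 / 2) ^ q" for i
    unfolding B2_def using p by (intro many_hits) auto
  let ?B = "(\<Union>i\<in>{..I}. B1 i) \<union> (\<Union>i\<in>{..<I}. B2 i)"
  show thesis
  proof (rule that)
    show "?B \<in> sets \<Omega>" by measurable
    have "measure \<Omega> ?B \<le> measure \<Omega> (\<Union>i\<in>{..I}. B1 i) + measure \<Omega> (\<Union>i\<in>{..<I}. B2 i)"
      by (rule measure_Un_le) measurable
    also have "\<dots> \<le> (\<Sum>i\<in>{..I}. measure \<Omega> (B1 i)) + (\<Sum>i\<in>{..<I}. measure \<Omega> (B2 i))"
      by (intro add_mono measure_UNION_le) auto
    also have "\<dots> \<le> (\<Sum>i\<in>{..I}. (1 / 2) ^ q) + (\<Sum>i\<in>{..<I}. (1 / 2) ^ q)"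
      by (intro add_mono sum_mono B1m B2m)
    also have "\<dots> = (2 * I + 1) * (1 / 2) ^ q" by (simp add: algebra_simps)
    finally show "measure \<Omega> ?B \<le> (2 * I + 1) * (1 / 2) ^ q" .
    fix S assume S: "S \<in> space \<Omega> - ?B"
    have massN: "mass {..<N i} S \<le> 2 * p (2 ^ i)" if i: "i \<le> I" for i
    proof -
      \<comment> \<open>One block with small mass suffices: it is part of the first
        \<open>N i\<close> examples, and more examples only shrink the region.\<close>
      from S i have "S \<notin> B1 i" "S \<in> space \<Omega>" by auto
      then obtain r where r: "r < q" "mass (blk i r) S \<le> 2 * p (2 ^ i)"
        by (force simp: B1_def not_less)
      have "Suc r * 2 ^ i \<le> N i" unfolding N_def using r(1) by (intro mult_right_mono) auto
      then have "blk i r \<subseteq> {..<N i}" by (auto simp: blk_def)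
      then have "mass {..<N i} S \<le> mass (blk i r) S"
        using S by (intro mass_antimono) auto
      with r(2) show ?thesis by simp
    qed
    from massN[of I] show "mass {..<q * 2 ^ I} S \<le> 2 * p (2 ^ I)" by (simp add: N_def)
    have "real (\<Sum>j<N i. of_bool (S j \<in> R (S ` {..<j})))
      \<le> q + (\<Sum>i<i. 4 * q * 2 ^ i * p (2 ^ i) + q)" if "i \<le> I" for i
      using that
    proof (induction i)
      \<comment> \<open>\<open>N 0 = q\<close>: all of the first \<open>q\<close> examples may be
        requests.\<close>
      case 0
      have "(\<Sum>j<q. of_bool (S j \<in> R (S ` {..<j})) :: nat) \<le> (\<Sum>j<q. 1)"
        by (intro sum_mono) auto
      then show ?case by (simp add: N_def)
    next
      case (Suc i)
      have "N i \<le> N (Suc i)" by (simp add: N_def)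
      let ?h = "\<lambda>j. of_bool (S j \<in> R (S ` {..<j})) :: nat"
      have "sum ?h {..<N (Suc i)} = sum ?h {..<N i} + sum ?h {N i..<N (Suc i)}"
        using sum.atLeastLessThan_concat[of 0 "N i" "N (Suc i)" ?h] \<open>N i \<le> N (Suc i)\<close>
        by (simp add: lessThan_atLeast0)
      moreover have "(\<Sum>j\<in>{N i..<N (Suc i)}. of_bool (S j \<in> R (S ` {..<j})) :: nat)
          \<le> (\<Sum>j\<in>{N i..<N (Suc i)}. of_bool (S j \<in> R (S ` {..<N i})))"
      proof (rule sum_mono)
        fix j assume "j \<in> {N i..<N (Suc i)}"
        then have "R (S ` {..<j}) \<subseteq> R (S ` {..<N i})" by (intro region_antimono) auto
        then show "(of_bool (S j \<in> R (S ` {..<j})) :: nat) \<le> of_bool (S j \<in> R (S ` {..<N i}))"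
          by auto
      qed
      moreover have "real (\<Sum>j\<in>{N i..<N (Suc i)}. of_bool (S j \<in> R (S ` {..<N i})))
          \<le> 4 * q * 2 ^ i * p (2 ^ i) + q"
      proof -
        have "S \<notin> B2 i" using S Suc.prems by auto
        then show ?thesis using S massN[of i] Suc.prems unfolding B2_def cardN by auto
      qed
      ultimately have "real (sum ?h {..<N (Suc i)}) \<le> real (sum ?h {..<N i}) + (4 * q * 2 ^ i * p (2 ^ i) + q)"
        by linarith
      also have "real (sum ?h {..<N i}) \<le> q + (\<Sum>i<i. 4 * q * 2 ^ i * p (2 ^ i) + q)"
        using Suc by simp
      finally show ?case by simp
    qed
    from this[of I] show "real (\<Sum>j<q * 2 ^ I. of_bool (S j \<in> R (S ` {..<j})))
      \<le> q + (\<Sum>i<I. 4 * q * 2 ^ i * p (2 ^ i) + q)" by (simp add: N_def)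
  qed
qed

end

section \<open>Normal distributions with diagonal covariance\<close>

lemma borel_measurable_linear:
  fixes f :: "'a::euclidean_space \<Rightarrow> 'b::real_normed_vector"
  assumes "linear f" shows "f \<in> borel_measurable borel"
  using assms by (simp add: borel_measurable_continuous_onI linear_continuous_on linear_conv_bounded_linear)

lemma nn_integral_lborel_translate:
  fixes f :: "'a::euclidean_space \<Rightarrow> ennreal"
  assumes [measurable]: "f \<in> borel_measurable borel"
  shows "(\<integral>\<^sup>+x. f (c + x) \<partial>lborel) = (\<integral>\<^sup>+x. f x \<partial>lborel)"
proof -
  have "(\<integral>\<^sup>+x. f x \<partial>lborel) = (\<integral>\<^sup>+x. f x \<partial>distr lborel borel ((+) c))"
    by (simp only: lborel_distr_plus)
  then show ?thesis by (simp add: nn_integral_distr)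
qed

text \<open>Uniqueness of Haar measure: the product of \<open>\<integral>f \<circ> R\<close> with the volume of the unit ball is
  rewritten by translations and Tonelli's theorem, using that the ball is invariant under \<open>R\<close>.\<close>

lemma lborel_distr_orthogonal:
  fixes R :: "'a::euclidean_space \<Rightarrow> 'a"
  assumes R: "orthogonal_transformation R"
  shows "distr lborel borel R = lborel"
proof (rule measure_eqI)
  show "sets (distr lborel borel R) = sets lborel" by simp
  have lin: "linear R" and nm: "norm (R x) = norm x" and "surj R" for x
    using R by (auto simp: orthogonal_transformation orthogonal_transformation_surj)
  have [measurable]: "R \<in> borel_measurable borel"
    by (rule borel_measurable_linear[OF lin])
  fix A :: "'a set" assume "A \<in> sets (distr lborel borel R)"
  then have [measurable]: "A \<in> sets borel" by simp
  define f where "f = (indicator A :: 'a \<Rightarrow> ennreal)"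
  define g where "g = (indicator (ball 0 1) :: 'a \<Rightarrow> ennreal)"
  have [measurable]: "f \<in> borel_measurable borel" "g \<in> borel_measurable borel"
    unfolding f_def g_def by (auto intro!: borel_measurable_indicator)
  let ?a = "\<integral>\<^sup>+y. g y \<partial>lborel"
  have gR: "g (- R x) = g x" for x by (simp add: g_def indicator_def nm)
  have "(\<integral>\<^sup>+x. f (R x) \<partial>lborel) * ?a = (\<integral>\<^sup>+x. \<integral>\<^sup>+y. f (R x) * g y \<partial>lborel \<partial>lborel)"
    by (simp add: nn_integral_cmult nn_integral_multc)
  also have "\<dots> = (\<integral>\<^sup>+y. \<integral>\<^sup>+x. f (R x) * g y \<partial>lborel \<partial>lborel)"
    by (rule lborel_pair.Fubini') measurable
  also have "\<dots> = (\<integral>\<^sup>+y. \<integral>\<^sup>+x. f (y + R x) * g y \<partial>lborel \<partial>lborel)"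
  proof (rule nn_integral_cong)
    fix y :: 'a
    \<comment> \<open>Shifting \<open>x\<close> by a preimage of \<open>y\<close> turns
      \<open>R x\<close> into \<open>y + R x\<close>.\<close>
    obtain y' where y': "R y' = y" using \<open>surj R\<close> by (metis surjD)
    have "(\<integral>\<^sup>+x. f (R (y' + x)) * g y \<partial>lborel) = (\<integral>\<^sup>+x. f (R x) * g y \<partial>lborel)"
      by (rule nn_integral_lborel_translate[where f = "\<lambda>x. f (R x) * g y"]) measurable
    then show "(\<integral>\<^sup>+x. f (R x) * g y \<partial>lborel) = (\<integral>\<^sup>+x. f (y + R x) * g y \<partial>lborel)"
      by (simp add: linear_add[OF lin] y')
  qed
  also have "\<dots> = (\<integral>\<^sup>+x. \<integral>\<^sup>+y. f (y + R x) * g y \<partial>lborel \<partial>lborel)"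
    by (rule lborel_pair.Fubini'[symmetric]) measurable
  also have "\<dots> = (\<integral>\<^sup>+x. \<integral>\<^sup>+y. f y * g (y - R x) \<partial>lborel \<partial>lborel)"
  proof (rule nn_integral_cong)
    fix x :: 'a
    have "(\<integral>\<^sup>+y. f (R x + y) * g (R x + y - R x) \<partial>lborel) = (\<integral>\<^sup>+y. f y * g (y - R x) \<partial>lborel)"
      by (rule nn_integral_lborel_translate[where f = "\<lambda>y. f y * g (y - R x)"]) measurable
    then show "(\<integral>\<^sup>+y. f (y + R x) * g y \<partial>lborel) = (\<integral>\<^sup>+y. f y * g (y - R x) \<partial>lborel)"
      by (simp add: add.commute)
  qed
  also have "\<dots> = (\<integral>\<^sup>+y. \<integral>\<^sup>+x. f y * g (y - R x) \<partial>lborel \<partial>lborel)"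
    by (rule lborel_pair.Fubini') measurable
  also have "\<dots> = (\<integral>\<^sup>+y. f y * ?a \<partial>lborel)"
  proof (rule nn_integral_cong)
    fix y :: 'a
    obtain y' where y': "R y' = y" using \<open>surj R\<close> by (metis surjD)
    have "(\<integral>\<^sup>+x. g (y - R (y' + x)) \<partial>lborel) = (\<integral>\<^sup>+x. g (y - R x) \<partial>lborel)"
      by (rule nn_integral_lborel_translate[where f = "\<lambda>x. g (y - R x)"]) measurable
    then have "(\<integral>\<^sup>+x. g (y - R x) \<partial>lborel) = ?a"
      by (simp add: linear_add[OF lin] y' gR)
    then show "(\<integral>\<^sup>+x. f y * g (y - R x) \<partial>lborel) = f y * ?a"
      by (simp add: nn_integral_cmult)
  qed
  also have "\<dots> = (\<integral>\<^sup>+y. f y \<partial>lborel) * ?a"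
    by (rule nn_integral_multc) measurable
  finally have eq: "(\<integral>\<^sup>+x. f (R x) \<partial>lborel) * ?a = (\<integral>\<^sup>+y. f y \<partial>lborel) * ?a" .
  have a: "?a = emeasure lborel (ball (0::'a) 1)" by (simp add: g_def)
  have "?a \<noteq> 0" unfolding a using emeasure_lborel_ball_finite[of 0 1] content_ball_pos[of 1 "0::'a"]
    by (auto simp: measure_def)
  moreover have "?a \<noteq> \<infinity>" unfolding a using emeasure_lborel_ball_finite[of "0::'a" 1] by simp
  ultimately have "(\<integral>\<^sup>+x. f (R x) \<partial>lborel) = (\<integral>\<^sup>+y. f y \<partial>lborel)"
    using eq ennreal_mult_divide_eq[of ?a] by (metis infinity_ennreal_def)
  then have "(\<integral>\<^sup>+x. f x \<partial>distr lborel borel R) = (\<integral>\<^sup>+y. f y \<partial>lborel)"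
    by (simp add: nn_integral_distr)
  then show "emeasure (distr lborel borel R) A = emeasure lborel A"
    by (simp add: f_def)
qed

section \<open>The standard normal distribution and its affine images\<close>

definition std_gauss :: "(real ^ 'k) measure" where
  "std_gauss = density lborel (\<lambda>z. ennreal (\<Prod>i\<in>UNIV. std_normal_density (z $ i)))"

definition std_gauss1 :: "real measure" where
  "std_gauss1 = density lborel (\<lambda>u. ennreal (std_normal_density u))"

lemma sets_std_gauss [simp, measurable_cong]: "sets std_gauss = sets borel"
  and sets_std_gauss1 [simp, measurable_cong]: "sets std_gauss1 = sets borel"
  and space_std_gauss [simp]: "space std_gauss = UNIV"
  and space_std_gauss1 [simp]: "space std_gauss1 = UNIV"
  by (simp_all add: std_gauss_def std_gauss1_def)

lemma prob_space_std_gauss1: "prob_space std_gauss1"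
  unfolding std_gauss1_def by (rule prob_space_normal_density) simp

lemma Basis_vec_real: "(Basis :: (real ^ 'k) set) = range (\<lambda>i. axis i 1)"
  by (auto simp: Basis_vec_def)

lemma inj_axis_one: "inj (\<lambda>i. axis i (1::real))"
  by (auto simp: inj_on_def axis_eq_axis)

text \<open>Independence of the coordinates, in the form in which orthants and weights are
  integrated: density and integrand are both products, so Tonelli's theorem applies factor by
  factor.\<close>

lemma nn_integral_std_gauss_prod:
  fixes f :: "'k::finite \<Rightarrow> real \<Rightarrow> ennreal"
  assumes [measurable]: "\<And>i. f i \<in> borel_measurable borel"
  shows "(\<integral>\<^sup>+z. (\<Prod>i\<in>UNIV. f i (z $ i)) \<partial>std_gauss) = (\<Prod>i\<in>UNIV. \<integral>\<^sup>+u. f i u \<partial>std_gauss1)"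
proof -
  let ?h = "\<lambda>i u. ennreal (std_normal_density u) * f i u"
  have "(\<integral>\<^sup>+z. (\<Prod>i\<in>UNIV. f i (z $ i)) \<partial>std_gauss)
      = (\<integral>\<^sup>+z. (\<Prod>i\<in>UNIV. ?h i (z $ i)) \<partial>lborel)"
    unfolding std_gauss_def
    by (subst nn_integral_density) (auto simp: prod.distrib prod_ennreal)
  also have "\<dots> = (\<integral>\<^sup>+z. (\<Prod>b\<in>(Basis :: (real ^ 'k) set). ?h (axis_index b) (z \<bullet> b)) \<partial>lborel)"
    unfolding Basis_vec_real
    by (simp add: prod.reindex[OF inj_axis_one] inner_axis axis_index_axis)
  also have "\<dots> = (\<Prod>b\<in>(Basis :: (real ^ 'k) set). \<integral>\<^sup>+u. ?h (axis_index b) u \<partial>lborel)"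
    by (rule nn_integral_lborel_prod[where f = "\<lambda>b. ?h (axis_index b)"]) auto
  also have "\<dots> = (\<Prod>i\<in>UNIV. \<integral>\<^sup>+u. ?h i u \<partial>lborel)"
    unfolding Basis_vec_real by (simp add: prod.reindex[OF inj_axis_one] axis_index_axis)
  also have "\<dots> = (\<Prod>i\<in>UNIV. \<integral>\<^sup>+u. f i u \<partial>std_gauss1)"
    unfolding std_gauss1_def by (simp add: nn_integral_density)
  finally show ?thesis .
qed

text \<open>A function of the norm alone, hence unchanged by orthogonal maps.\<close>

lemma std_gauss_density_norm:
  "(\<Prod>i\<in>UNIV. std_normal_density (z $ i)) = exp (- (norm (z :: real ^ 'k))\<^sup>2 / 2) / sqrt ((2 * pi) ^ CARD('k))"
proof -
  have "(\<Prod>i\<in>UNIV. std_normal_density (z $ i)) = (\<Prod>i\<in>(UNIV::'k set). 1 / sqrt (2 * pi)) * exp (\<Sum>i\<in>UNIV. - (z $ i)\<^sup>2 / 2)"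
    unfolding std_normal_density_def prod.distrib exp_sum[OF finite] ..
  also have "(\<Sum>i\<in>UNIV. - (z $ i)\<^sup>2 / 2) = - (norm z)\<^sup>2 / 2"
    by (simp add: norm_vec_def L2_set_def sum_nonneg sum_negf sum_divide_distrib)
  also have "(\<Prod>i\<in>(UNIV::'k set). 1 / sqrt (2 * pi)) = 1 / sqrt ((2 * pi) ^ CARD('k))"
    by (simp only: prod_constant power_one_over real_sqrt_power)
  finally show ?thesis by simp
qed

lemma std_gauss_distr_orthogonal:
  fixes R :: "real ^ 'k \<Rightarrow> real ^ 'k"
  assumes R: "orthogonal_transformation R"
  shows "distr std_gauss borel R = std_gauss"
proof -
  have "R \<in> borel_measurable borel"
    by (rule borel_measurable_linear[OF orthogonal_transformation_linear[OF R]])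
  then have [measurable]: "R \<in> lborel \<rightarrow>\<^sub>M borel" by simp
  let ?f = "\<lambda>z :: real ^ 'k. ennreal (\<Prod>i\<in>UNIV. std_normal_density (z $ i))"
  have "distr std_gauss borel R = distr (density lborel (\<lambda>z. ?f (R z))) borel R"
    unfolding std_gauss_def std_gauss_density_norm
    using R by (simp add: orthogonal_transformation)
  also have "\<dots> = density (distr lborel borel R) ?f"
    by (rule density_distr[symmetric]) measurable
  finally show ?thesis by (simp add: lborel_distr_orthogonal[OF R] std_gauss_def)
qed


lemma sqrt_prod: "sqrt (prod f A) = (\<Prod>i\<in>A. sqrt (f i))"
  by (induction A rule: infinite_finite_induct) (auto simp: real_sqrt_mult)

text \<open>The Jacobian of the scaling is the product of the standard deviations, which is the
  ratio of the two normalising constants.\<close>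

lemma std_gauss_distr_scale:
  fixes \<mu> d :: "real ^ 'k"
  assumes d: "\<And>i. 0 < d $ i"
  shows "distr std_gauss borel (\<lambda>z. \<mu> + (\<chi> i. sqrt (d $ i) * z $ i))
    = density lborel (\<lambda>x. ennreal (exp (- (\<Sum>i\<in>UNIV. (x $ i - \<mu> $ i)\<^sup>2 / d $ i) / 2)
        / sqrt ((2 * pi) ^ CARD('k) * (\<Prod>i\<in>UNIV. d $ i))))"
proof -
  define c where "c b = sqrt (d $ axis_index b)" for b :: "real ^ 'k"
  define T where "T z = \<mu> + (\<chi> i. sqrt (d $ i) * z $ i)" for z :: "real ^ 'k"
  let ?f = "\<lambda>x. ennreal (exp (- (\<Sum>i\<in>UNIV. (x $ i - \<mu> $ i)\<^sup>2 / d $ i) / 2)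
        / sqrt ((2 * pi) ^ CARD('k) * (\<Prod>i\<in>UNIV. d $ i)))"
  let ?k = "\<Prod>i\<in>UNIV. sqrt (d $ i)"
  have T: "T z = \<mu> + (\<Sum>j\<in>Basis. (c j * (z \<bullet> j)) *\<^sub>R j)" for z
    unfolding Basis_vec_real T_def c_def
    by (subst sum.reindex[OF inj_axis_one])
      (simp add: axis_index_axis inner_axis vec_eq_iff, simp add: axis_def if_distrib cong: if_cong)
  have [measurable]: "T \<in> lborel \<rightarrow>\<^sub>M borel"
    unfolding T by measurable
  have k: "?k > 0" using d by (intro prod_pos) simp
  have "lborel = density (distr lborel borel T) (\<lambda>_. \<Prod>j\<in>Basis. \<bar>c j\<bar>)"
    unfolding T by (rule lborel_affine_euclidean)
      (use d in \<open>auto simp: c_def Basis_vec_real axis_index_axis less_imp_neq[symmetric]\<close>)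
  also have "(\<Prod>j\<in>Basis. \<bar>c j\<bar>) = ?k"
    unfolding Basis_vec_real c_def using d
    by (simp add: prod.reindex[OF inj_axis_one] axis_index_axis less_imp_le)
  finally have lb: "lborel = density (distr lborel borel T) (\<lambda>_. ennreal ?k)" .
  have "density lborel ?f = density (distr lborel borel T) (\<lambda>x. ennreal ?k * ?f x)"
    by (subst lb, subst density_density_eq) auto
  also have "\<dots> = distr (density lborel (\<lambda>z. ennreal ?k * ?f (T z))) borel T"
    by (rule density_distr) measurable
  also have "density lborel (\<lambda>z. ennreal ?k * ?f (T z)) = std_gauss"
  proof -
    have "ennreal ?k * ?f (T z) = ennreal (\<Prod>i\<in>UNIV. std_normal_density (z $ i))" for z
    proof -
      have "(\<Sum>i\<in>UNIV. (T z $ i - \<mu> $ i)\<^sup>2 / d $ i) = (norm z)\<^sup>2"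
        using d by (simp add: T_def power_mult_distrib less_imp_le less_imp_neq[symmetric]
            norm_vec_def L2_set_def sum_nonneg)
      moreover have "sqrt ((2 * pi) ^ CARD('k) * (\<Prod>i\<in>UNIV. d $ i)) = sqrt ((2 * pi) ^ CARD('k)) * ?k"
        by (simp add: real_sqrt_mult sqrt_prod)
      ultimately show ?thesis
        unfolding std_gauss_density_norm using k
        by (subst ennreal_mult[symmetric]) (auto intro!: prod_nonneg simp: less_imp_le[OF d] less_imp_neq[OF d, symmetric])
    qed
    then show ?thesis by (simp add: std_gauss_def)
  qed
  finally show ?thesis by (simp add: T_def[abs_def])
qed

text \<open>Semidefiniteness excludes negative entries; a zero entry would put an axis vector into
  the kernel, against full rank.\<close>

lemma diagonal_covariance_pos:
  fixes C :: "real ^ 'k ^ 'k"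
  assumes C: "covariance_matrix C" "diagonal_matrix C" "rank C = CARD('k)"
  shows "0 < C $ i $ i"
proof -
  have Ci: "C *v axis i 1 = axis i (C $ i $ i)"
    using C(2) by (auto simp: matrix_vector_mul_component diagonal_matrix_def vec_eq_iff
        axis_def matrix_vector_mult_def if_distrib cong: if_cong)
  have "0 \<le> axis i 1 \<bullet> (C *v axis i 1)" using C(1) by (simp add: covariance_matrix_def)
  then have "0 \<le> C $ i $ i" unfolding Ci by (simp add: inner_axis_axis)
  moreover have "C $ i $ i \<noteq> 0"
  proof
    assume "C $ i $ i = 0"
    then have "C *v axis i 1 = C *v 0" unfolding Ci by simp
    then have "axis i 1 = (0 :: real ^ 'k)"
      using C(3) full_rank_injective[of C] by (metis injD)
    then show False by simp
  qed
  ultimately show ?thesis by simp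
qed

lemma diagonal_normal_eq:
  fixes C :: "real ^ 'k ^ 'k"
  assumes C: "covariance_matrix C" "diagonal_matrix C" "rank C = CARD('k)"
  shows "multivariate_normal \<mu> C = distr std_gauss borel (\<lambda>z. \<mu> + (\<chi> i. sqrt (C $ i $ i) * z $ i))"
proof -
  let ?d = "(\<chi> i. C $ i $ i) :: real ^ 'k"
  have d: "0 < ?d $ i" for i using diagonal_covariance_pos[OF C] by simp
  have inv: "invertible C"
    using C(3) by (simp add: full_rank_injective invertible_left_inverse matrix_left_invertible_injective)
  have "x \<bullet> (matrix_inv C *v x) = (\<Sum>i\<in>UNIV. (x $ i)\<^sup>2 / C $ i $ i)" for x
  proof -
    have "C *v (\<chi> i. x $ i / C $ i $ i) = x"
    proof -
      have "(\<Sum>j\<in>UNIV. C $ i $ j * (x $ j / C $ j $ j)) = (\<Sum>j\<in>UNIV. if j = i then x $ j else 0)" for i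
        using C(2) d by (intro sum.cong) (auto simp: diagonal_matrix_def less_imp_neq[symmetric])
      then show ?thesis by (simp add: vec_eq_iff matrix_vector_mult_def)
    qed
    then have "matrix_inv C *v x = matrix_inv C *v (C *v (\<chi> i. x $ i / C $ i $ i))" by simp
    also have "\<dots> = (\<chi> i. x $ i / C $ i $ i)"
      \<comment> \<open>\<open>matrix_inv\<close> is a Hilbert choice, so the inverse property is
        extracted from the existence of an inverse.\<close>
      using someI_ex[OF inv[unfolded invertible_def]]
      by (simp add: matrix_vector_mul_assoc matrix_inv_def)
    finally show ?thesis by (simp add: inner_vec_def power2_eq_square)
  qed
  moreover have "det C = (\<Prod>i\<in>UNIV. C $ i $ i)"
    using C(2) by (intro det_diagonal) (auto simp: diagonal_matrix_def)
  ultimately show ?thesis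
    using std_gauss_distr_scale[of ?d \<mu>, OF d] by (simp add: multivariate_normal_def)
qed

text \<open>The rotation sends the normal vector \<open>w\<close> of the target to a coordinate axis, so that the
  target becomes a condition on a single coordinate while the distribution stays a product.\<close>

lemma diagonal_normal_frame:
  fixes w :: "real ^ 'k" and i\<^sub>0 :: 'k
  assumes "\<nu> \<in> diagonal_normals"
  obtains T T' A \<kappa> where "T \<in> borel_measurable borel" "T' \<in> borel_measurable borel"
    "\<And>x. T (T' x) = x" "\<And>z. T' (T z) = z" "\<nu> = distr std_gauss borel T"
    "\<And>v z z'. (T z - T z') \<bullet> v = (z - z') \<bullet> A v" "A w = \<kappa> *\<^sub>R axis i\<^sub>0 1"
proof -
  from assms obtain \<mu> C where \<nu>: "\<nu> = multivariate_normal \<mu> C"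
    and C: "covariance_matrix C" "diagonal_matrix C" "rank C = CARD('k)"
    by (auto simp: diagonal_normals_def)
  note Cpos = diagonal_covariance_pos[OF C]
  define D where "D z = (\<chi> i. sqrt (C $ i $ i) * z $ i)" for z :: "real ^ 'k"
  define D' where "D' z = (\<chi> i. z $ i / sqrt (C $ i $ i))" for z :: "real ^ 'k"
  have D: "linear D" "linear D'" by (auto simp: D_def D'_def linear_iff vec_eq_iff algebra_simps add_divide_distrib)
  have DD': "D (D' z) = z" "D' (D z) = z" for z
    using Cpos by (auto simp: D_def D'_def vec_eq_iff less_imp_neq[symmetric])
  \<comment> \<open>The functional with vector \<open>w\<close> pulls back through the symmetric
    \<open>D\<close> and the orthogonal \<open>R\<close> to the vector \<open>R' (D w)\<close>. So
    it is \<open>D w\<close>, not \<open>w\<close>, that has to be the image of a multiple of the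
    axis.\<close>
  obtain R :: "real ^ 'k \<Rightarrow> real ^ 'k" where R: "orthogonal_transformation R"
    and Rw: "R (norm (D w) *\<^sub>R axis i\<^sub>0 1) = D w"
    by (rule orthogonal_transformation_exists[of "norm (D w) *\<^sub>R axis i\<^sub>0 1" "D w"]) simp
  define R' where "R' = inv R"
  have R': "orthogonal_transformation R'" unfolding R'_def by (rule orthogonal_transformation_inv[OF R])
  have RR': "R (R' z) = z" "R' (R z) = z" for z
    using R unfolding R'_def
    by (auto simp: orthogonal_transformation_inj orthogonal_transformation_surj inv_f_f surj_f_inv_f)
  have mR: "R \<in> borel_measurable borel" "R' \<in> borel_measurable borel"
    using R R' by (auto intro!: borel_measurable_linear orthogonal_transformation_linear)
  have mD: "D \<in> borel_measurable borel" "D' \<in> borel_measurable borel"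
    using D by (auto intro!: borel_measurable_linear)
  note [measurable] = mR mD
  show thesis
  proof (rule that)
    show "(\<lambda>z. \<mu> + D (R z)) \<in> borel_measurable borel" by measurable
    show "(\<lambda>x. R' (D' (x - \<mu>))) \<in> borel_measurable borel" by measurable
    show "\<mu> + D (R (R' (D' (x - \<mu>)))) = x" for x by (simp add: RR' DD')
    show "R' (D' (\<mu> + D (R z) - \<mu>)) = z" for z by (simp add: RR' DD')
    have "\<nu> = distr std_gauss borel (\<lambda>z. \<mu> + D z)"
      unfolding \<nu> diagonal_normal_eq[OF C] D_def ..
    \<comment> \<open>Rotational invariance inserts \<open>R\<close> at no cost.\<close>
    also have "\<dots> = distr (distr std_gauss borel R) borel (\<lambda>z. \<mu> + D z)"
      by (simp only: std_gauss_distr_orthogonal[OF R])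
    also have "\<dots> = distr std_gauss borel ((\<lambda>z. \<mu> + D z) \<circ> R)"
      by (rule distr_distr) measurable
    finally show "\<nu> = distr std_gauss borel (\<lambda>z. \<mu> + D (R z))" by (simp add: comp_def)
    show "(\<mu> + D (R z) - (\<mu> + D (R z'))) \<bullet> v = (z - z') \<bullet> R' (D v)" for v z z'
    proof -
      have "(\<mu> + D (R z) - (\<mu> + D (R z'))) \<bullet> v = D (R (z - z')) \<bullet> v"
        using D(1) R by (simp add: linear_diff orthogonal_transformation_linear)
      also have "\<dots> = R (z - z') \<bullet> D v"
        by (simp add: D_def inner_vec_def mult_ac)
      also have "\<dots> = R (z - z') \<bullet> R (R' (D v))" by (simp add: RR')
      also have "\<dots> = (z - z') \<bullet> R' (D v)" using R by (simp add: orthogonal_transformation_def)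
      finally show ?thesis .
    qed
    show "R' (D w) = norm (D w) *\<^sub>R axis i\<^sub>0 1" using Rw RR'(2) by metis
  qed
qed


section \<open>Orthants under the standard normal distribution\<close>

text \<open>Of any two points of \<open>A\<close> one lies in the half-line of the other. Hence integrating the mass
  of the half-line within \<open>A\<close> over \<open>A\<close> gives at least half the square of the mass of \<open>A\<close>.\<close>

lemma half_line_mass:
  fixes G :: "real measure" and s :: real
  assumes G: "prob_space G" and [measurable_cong]: "sets G = sets borel"
    and [measurable]: "A \<in> sets borel"
    and le: "\<And>u. u \<in> A \<Longrightarrow> emeasure G (A \<inter> {y. 0 \<le> s * (y - u)}) \<le> ennreal \<tau>"
  shows "emeasure G A \<le> ennreal (2 * \<tau>)"
proof -
  interpret prob_space G by fact
  interpret GG: pair_prob_space G G ..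
  let ?h = "\<lambda>u y. indicator A u * (indicator A y * indicator {d. 0 \<le> s * d} (y - u)) :: ennreal"
  have slice: "(\<integral>\<^sup>+y. ?h u y \<partial>G) \<le> ennreal \<tau> * indicator A u" for u
  proof -
    have "(\<integral>\<^sup>+y. ?h u y \<partial>G) = indicator A u * (\<integral>\<^sup>+y. indicator A y * indicator {d. 0 \<le> s * d} (y - u) \<partial>G)"
      by (rule nn_integral_cmult) measurable
    also have "(\<integral>\<^sup>+y. indicator A y * indicator {d. 0 \<le> s * d} (y - u) \<partial>G)
        = (\<integral>\<^sup>+y. indicator (A \<inter> {y. 0 \<le> s * (y - u)}) y \<partial>G)"
      by (intro nn_integral_cong) (auto simp: indicator_def)
    also have "\<dots> = emeasure G (A \<inter> {y. 0 \<le> s * (y - u)})"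
      by (rule nn_integral_indicator) measurable
    finally show ?thesis using le[of u] by (auto simp: indicator_def)
  qed
  have "emeasure G A * emeasure G A = (\<integral>\<^sup>+u. \<integral>\<^sup>+y. indicator A u * indicator A y \<partial>G \<partial>G)"
    by (simp add: nn_integral_cmult nn_integral_multc)
  also have "\<dots> \<le> (\<integral>\<^sup>+u. \<integral>\<^sup>+y. ?h u y + ?h y u \<partial>G \<partial>G)"
  proof (intro nn_integral_mono)
    fix u y :: real
    have "0 \<le> s * (y - u) \<or> 0 \<le> s * (u - y)"
      by (metis le_cases minus_diff_eq mult_minus_right neg_0_le_iff_le)
    then show "indicator A u * indicator A y \<le> ?h u y + ?h y u" by (auto simp: indicator_def)
  qed
  also have "\<dots> = (\<integral>\<^sup>+u. (\<integral>\<^sup>+y. ?h u y \<partial>G) + (\<integral>\<^sup>+y. ?h y u \<partial>G) \<partial>G)"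
    by (intro nn_integral_cong nn_integral_add) measurable
  also have "\<dots> = (\<integral>\<^sup>+u. \<integral>\<^sup>+y. ?h u y \<partial>G \<partial>G) + (\<integral>\<^sup>+u. \<integral>\<^sup>+y. ?h y u \<partial>G \<partial>G)"
    by (rule nn_integral_add) measurable
  also have "(\<integral>\<^sup>+u. \<integral>\<^sup>+y. ?h y u \<partial>G \<partial>G) = (\<integral>\<^sup>+u. \<integral>\<^sup>+y. ?h u y \<partial>G \<partial>G)"
    by (rule GG.Fubini') measurable
  also have "(\<integral>\<^sup>+u. \<integral>\<^sup>+y. ?h u y \<partial>G \<partial>G) \<le> (\<integral>\<^sup>+u. ennreal \<tau> * indicator A u \<partial>G)"
    by (intro nn_integral_mono slice)
  also have "\<dots> = ennreal \<tau> * emeasure G A" by (simp add: nn_integral_cmult)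
  finally have *: "emeasure G A * emeasure G A \<le> (2 * ennreal \<tau>) * emeasure G A"
    by (simp add: mult_2 distrib_right add_mono)
  have "emeasure G A \<le> 2 * ennreal \<tau>"
  proof (cases "emeasure G A = 0")
    case False
    then show ?thesis using divide_right_mono_ennreal[OF *, of "emeasure G A"]
      by (simp add: ennreal_mult_divide_eq emeasure_eq_measure)
  qed simp
  then show ?thesis by (simp add: ennreal_mult')
qed

text \<open>One factor of the mass of an orthant at a point with coordinate \<open>u\<close>: the
  half-line from \<open>u\<close> in the direction \<open>s\<close>, cut down to the side of
  \<open>I\<close> on which \<open>u\<close> lies. With \<open>I = UNIV\<close> the cut is
  void.\<close>

definition orthant_mass :: "real set \<Rightarrow> real \<Rightarrow> real \<Rightarrow> real" where
  "orthant_mass I s u = measure std_gauss1 {y. 0 \<le> s * (y - u) \<and> (y \<in> I \<longleftrightarrow> u \<in> I)}"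

lemma orthant_mass_nonneg: "0 \<le> orthant_mass I s u"
  and orthant_mass_le_1: "orthant_mass I s u \<le> 1"
  using prob_space.prob_le_1[OF prob_space_std_gauss1] by (auto simp: orthant_mass_def)

lemma orthant_mass_measurable [measurable]:
  assumes [measurable]: "I \<in> sets borel"
  shows "orthant_mass I s \<in> borel_measurable borel"
proof -
  interpret prob_space std_gauss1 by (rule prob_space_std_gauss1)
  let ?Q = "{p \<in> space (borel \<Otimes>\<^sub>M std_gauss1). 0 \<le> s * (snd p - fst p) \<and> (snd p \<in> I \<longleftrightarrow> fst p \<in> I)}"
  have "?Q \<in> sets (borel \<Otimes>\<^sub>M std_gauss1)" by measurable
  then have "(\<lambda>u. measure std_gauss1 (Pair u -` ?Q)) \<in> borel_measurable borel"
    unfolding measure_def by (intro borel_measurable_enn2real measurable_emeasure_Pair)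
  then show ?thesis
    by (simp add: orthant_mass_def[abs_def] space_pair_measure)
qed

text \<open>Split the set by membership in \<open>I\<close>. Within either part the condition
  \<open>y \<in> I \<longleftrightarrow> u \<in> I\<close> is automatic, so
  \<open>half_line_mass\<close> bounds each part by \<open>2 * \<tau>\<close>. Of the normal
  distribution only the total mass 1 enters.\<close>

lemma small_orthant_mass:
  assumes [measurable]: "I \<in> sets borel" and "0 \<le> \<tau>"
  shows "emeasure std_gauss1 {u. orthant_mass I s u \<le> \<tau>} \<le> ennreal (4 * \<tau>)"
proof -
  interpret prob_space std_gauss1 by (rule prob_space_std_gauss1)
  have half: "emeasure std_gauss1 {u. orthant_mass I s u \<le> \<tau> \<and> (u \<in> I \<longleftrightarrow> b)} \<le> ennreal (2 * \<tau>)" for b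
  proof (rule half_line_mass[where s = s])
    show "{u. orthant_mass I s u \<le> \<tau> \<and> (u \<in> I \<longleftrightarrow> b)} \<in> sets borel"
      by measurable
    fix u assume u: "u \<in> {u. orthant_mass I s u \<le> \<tau> \<and> (u \<in> I \<longleftrightarrow> b)}"
    have "{y \<in> space borel. 0 \<le> s * (y - u) \<and> (y \<in> I \<longleftrightarrow> u \<in> I)} \<in> sets borel" by measurable
    then have "emeasure std_gauss1 ({u. orthant_mass I s u \<le> \<tau> \<and> (u \<in> I \<longleftrightarrow> b)} \<inter> {y. 0 \<le> s * (y - u)})
        \<le> emeasure std_gauss1 {y. 0 \<le> s * (y - u) \<and> (y \<in> I \<longleftrightarrow> u \<in> I)}"
      using u by (intro emeasure_mono) auto
    also have "\<dots> = ennreal (orthant_mass I s u)"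
      by (simp add: orthant_mass_def emeasure_eq_measure)
    also have "\<dots> \<le> ennreal \<tau>" using u by (intro ennreal_leI) simp
    finally show "emeasure std_gauss1 ({u. orthant_mass I s u \<le> \<tau> \<and> (u \<in> I \<longleftrightarrow> b)} \<inter> {y. 0 \<le> s * (y - u)})
        \<le> ennreal \<tau>" .
  qed (simp_all add: prob_space_std_gauss1)
  have "{u. orthant_mass I s u \<le> \<tau>} = {u. orthant_mass I s u \<le> \<tau> \<and> (u \<in> I \<longleftrightarrow> True)}
      \<union> {u. orthant_mass I s u \<le> \<tau> \<and> (u \<in> I \<longleftrightarrow> False)}" by auto
  also have "emeasure std_gauss1 \<dots> \<le> emeasure std_gauss1 {u. orthant_mass I s u \<le> \<tau> \<and> (u \<in> I \<longleftrightarrow> True)}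
      + emeasure std_gauss1 {u. orthant_mass I s u \<le> \<tau> \<and> (u \<in> I \<longleftrightarrow> False)}"
    by (rule emeasure_subadditive) (simp; measurable)+
  also have "\<dots> \<le> ennreal (2 * \<tau>) + ennreal (2 * \<tau>)" by (intro add_mono half)
  also have "\<dots> = ennreal (4 * \<tau>)" using \<open>0 \<le> \<tau>\<close> by (subst ennreal_plus[symmetric]) auto
  finally show ?thesis .
qed

text \<open>With \<open>2\<close> in place of \<open>2 - 1 / N\<close> the weight would be comparable to \<open>1 / v\<close>, whose integral
  diverges logarithmically. The factor chosen here gives an integral of order \<open>N\<close> and loses only a
  constant for \<open>v \<ge> 2\<^sup>-\<^sup>N\<close>, since \<open>(1 - 1 / (2 * N)) ^ N \<ge> 1 / 2\<close>.\<close>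

definition dyadic_weight :: "nat \<Rightarrow> real \<Rightarrow> ennreal" where
  "dyadic_weight N v = (\<Sum>i. ennreal ((2 - 1 / N) ^ i) * indicator {..(1 / 2) ^ i} v)"

lemma dyadic_weight_measurable [measurable]: "dyadic_weight N \<in> borel_measurable borel"
  unfolding dyadic_weight_def[abs_def] by measurable

lemma dyadic_weight_ge:
  assumes "v \<le> (1 / 2) ^ i"
  shows "ennreal ((2 - 1 / N) ^ i) \<le> dyadic_weight N v"
proof -
  let ?f = "\<lambda>i. ennreal ((2 - 1 / N) ^ i) * indicator {..(1 / 2) ^ i} v"
  have "sum ?f {i} \<le> suminf ?f" by (rule sum_le_suminf) auto
  moreover have "sum ?f {i} = ennreal ((2 - 1 / N) ^ i)"
    using assms by (subst sum.insert) auto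
  ultimately show ?thesis by (simp only: dyadic_weight_def)
qed

text \<open>The tail bound \<open>4 * (1 / 2) ^ i\<close> turns the weight
  \<open>(2 * \<rho>) ^ i\<close> into \<open>4 * \<rho> ^ i\<close>, and this geometric series has
  the sum \<open>4 / (1 - \<rho>) = 8 * N\<close>.\<close>

lemma nn_integral_dyadic_weight_le:
  assumes [measurable]: "I \<in> sets borel" and "1 \<le> N"
  shows "(\<integral>\<^sup>+u. dyadic_weight N (orthant_mass I s u) \<partial>std_gauss1) \<le> ennreal (8 * real N)"
proof -
  define \<rho> where "\<rho> = 1 - 1 / (2 * real N)"
  have \<rho>: "0 \<le> \<rho>" "\<rho> < 1" using assms by (auto simp: \<rho>_def field_simps)
  have lam: "2 - 1 / real N = 2 * \<rho>" using assms by (simp add: \<rho>_def field_simps)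
  have "(\<integral>\<^sup>+u. dyadic_weight N (orthant_mass I s u) \<partial>std_gauss1)
      = (\<Sum>i. \<integral>\<^sup>+u. ennreal ((2 * \<rho>) ^ i) * indicator {..(1 / 2) ^ i} (orthant_mass I s u) \<partial>std_gauss1)"
    unfolding dyadic_weight_def lam by (rule nn_integral_suminf) measurable
  also have "\<dots> \<le> (\<Sum>i. ennreal (4 * \<rho> ^ i))"
  proof (rule suminf_le)
    fix i
    have "(\<integral>\<^sup>+u. ennreal ((2 * \<rho>) ^ i) * indicator {..(1 / 2) ^ i} (orthant_mass I s u) \<partial>std_gauss1)
      = (\<integral>\<^sup>+u. ennreal ((2 * \<rho>) ^ i) * indicator {u. orthant_mass I s u \<le> (1 / 2) ^ i} u \<partial>std_gauss1)"
      by (intro nn_integral_cong) (auto simp: indicator_def)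
    also have "\<dots> = ennreal ((2 * \<rho>) ^ i) * emeasure std_gauss1 {u. orthant_mass I s u \<le> (1 / 2) ^ i}"
      by (rule nn_integral_cmult_indicator) measurable
    also have "\<dots> \<le> ennreal ((2 * \<rho>) ^ i) * ennreal (4 * (1 / 2) ^ i)"
      by (intro mult_left_mono small_orthant_mass) auto
    also have "\<dots> = ennreal (4 * \<rho> ^ i)"
      using \<rho> by (subst ennreal_mult[symmetric]) (auto simp: power_mult_distrib power_one_over)
    finally show "(\<integral>\<^sup>+u. ennreal ((2 * \<rho>) ^ i) * indicator {..(1 / 2) ^ i} (orthant_mass I s u) \<partial>std_gauss1)
      \<le> ennreal (4 * \<rho> ^ i)" .
  qed auto
  also have "\<dots> = ennreal (4 * (1 / (1 - \<rho>)))"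
    using \<rho> by (intro suminf_ennreal_eq sums_mult geometric_sums) auto
  also have "4 * (1 / (1 - \<rho>)) = 8 * real N" using assms by (simp add: \<rho>_def)
  finally show ?thesis by simp
qed

lemma geometric_sum_le:
  fixes x :: real
  assumes "0 < x" "x \<le> 1" shows "(\<Sum>m<n. (1 - x) ^ m) \<le> 1 / x"
  using assms by (simp add: sum_gp_strict field_simps)

text \<open>The left side is at most 2^N and at most the reciprocal of the product of the
  \<open>v i\<close>, as \<open>a\<close> cancels in the geometric series. Each \<open>v i\<close>
  is rounded to a power of 1/2 with exponent \<open>r i\<close>. Rounding costs a factor 2 per
  coordinate, and passing from 2 to \<open>2 * \<rho>\<close> costs one more factor 2 while the
  exponents sum to less than \<open>N\<close>.\<close>

lemma sum_le_prod_dyadic_weight: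
  fixes v :: "'k::finite \<Rightarrow> real"
  assumes v: "\<And>i. 0 \<le> v i" "\<And>i. v i \<le> 1" and a: "0 \<le> a" "a \<le> 1" and N: "1 \<le> N"
  shows "ennreal (\<Sum>m<2 ^ N. a * (1 - a * (\<Prod>i\<in>UNIV. v i)) ^ m)
    \<le> ennreal (2 * 2 ^ CARD('k)) * (\<Prod>i\<in>UNIV. dyadic_weight N (v i))"
proof -
  let ?\<pi> = "\<Prod>i\<in>UNIV. v i"
  let ?L = "\<Sum>m<2 ^ N. a * (1 - a * ?\<pi>) ^ m"
  define \<rho> where "\<rho> = 1 - 1 / (2 * real N)"
  have \<rho>: "1 / 2 \<le> \<rho>" "\<rho> \<le> 1" using N by (auto simp: \<rho>_def field_simps)
  have lam: "2 - 1 / real N = 2 * \<rho>" using N by (simp add: \<rho>_def field_simps)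
  have \<rho>N: "1 / 2 \<le> \<rho> ^ N"
    using Bernoulli_inequality[of "- 1 / (2 * real N)" N] N by (simp add: \<rho>_def field_simps)
  have \<pi>: "0 \<le> ?\<pi>" "?\<pi> \<le> 1" using v by (auto intro: prod_nonneg prod_le_1)
  have a\<pi>: "0 \<le> a * ?\<pi>" "a * ?\<pi> \<le> 1" using a \<pi> by (auto intro: mult_le_one)
  \<comment> \<open>The cap \<open>N\<close> makes the greatest exponent exist even if
    \<open>v i = 0\<close>.\<close>
  define r where "r i = (GREATEST n. n \<le> N \<and> v i \<le> (1 / 2) ^ n)" for i
  have r: "r i \<le> N" "v i \<le> (1 / 2) ^ r i" "r i < N \<Longrightarrow> (1 / 2) ^ Suc (r i) < v i" for i
  proof -
    have ex: "0 \<le> N \<and> v i \<le> (1 / 2) ^ 0" using v by simp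
    have *: "r i \<le> N \<and> v i \<le> (1 / 2) ^ r i"
      unfolding r_def by (rule GreatestI_nat[where P = "\<lambda>n. n \<le> N \<and> v i \<le> (1 / 2) ^ n" and b = N, OF ex]) simp
    then show "r i \<le> N" "v i \<le> (1 / 2) ^ r i" by auto
    assume "r i < N"
    show "(1 / 2) ^ Suc (r i) < v i"
    proof (rule ccontr)
      assume "\<not> ?thesis"
      then have "Suc (r i) \<le> r i"
        unfolding r_def[of i] using \<open>r i < N\<close>
        by (intro Greatest_le_nat[where b = N]) (auto simp: r_def[symmetric])
      then show False by simp
    qed
  qed
  let ?r = "\<Sum>i\<in>UNIV. r i"
  have W: "ennreal ((2 * \<rho>) ^ ?r) \<le> (\<Prod>i\<in>UNIV. dyadic_weight N (v i))"
  proof -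
    have "ennreal ((2 * \<rho>) ^ ?r) = (\<Prod>i\<in>UNIV. ennreal ((2 * \<rho>) ^ r i))"
      using \<rho> by (simp add: power_sum prod_ennreal)
    also have "\<dots> \<le> (\<Prod>i\<in>UNIV. dyadic_weight N (v i))"
      using dyadic_weight_ge[OF r(2), of N] by (intro prod_mono_ennreal) (simp add: lam)
    finally show ?thesis .
  qed
  have "?L \<le> (2 * 2 ^ CARD('k)) * (2 * \<rho>) ^ ?r"
  proof (cases "?r < N")
    \<comment> \<open>The right side is at least of the order \<open>(2 * \<rho>) ^ N\<close>, which
      is no less than half of \<open>2 ^ N\<close>, so counting the terms suffices.\<close>
    case False
    have "?L \<le> (\<Sum>m<(2::nat) ^ N. 1)"
      using a a\<pi> by (intro sum_mono) (auto intro!: mult_le_one power_le_one)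
    also have "\<dots> \<le> 2 * (2 * \<rho>) ^ N" using \<rho>N by (simp add: power_mult_distrib)
    also have "\<dots> \<le> 2 * (2 * \<rho>) ^ ?r"
      using False \<rho> by (intro mult_left_mono power_increasing) auto
    also have "\<dots> \<le> (2 * 2 ^ CARD('k)) * (2 * \<rho>) ^ ?r"
      using \<rho> by (intro mult_right_mono) auto
    finally show ?thesis .
  next
    case True
    \<comment> \<open>No exponent reaches the cap, so every \<open>v i\<close> is positive and
      within a factor 2 of its rounded value.\<close>
    have ri: "r i < N" for i
      using True member_le_sum[of i UNIV r] by simp
    have pos: "0 < v i" for i using r(3)[OF ri[of i]] by (meson less_trans zero_less_power half_gt_zero zero_less_one)
    have lower: "(1 / 2) ^ (?r + CARD('k)) \<le> ?\<pi>"
    proof -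
      have "(1 / 2) ^ (?r + CARD('k)) = (\<Prod>i\<in>UNIV. (1 / 2 :: real) ^ Suc (r i))"
        by (simp only: power_add power_sum power_Suc prod.distrib prod_constant mult.commute)
      also have "\<dots> \<le> ?\<pi>" using r(3)[OF ri] by (intro prod_mono) (auto intro: less_imp_le)
      finally show ?thesis .
    qed
    have \<pi>pos: "0 < ?\<pi>" using pos by (intro prod_pos) auto
    have "?L \<le> 1 / ?\<pi>"
    proof (cases "a = 0")
      case False
      then have "?L \<le> a * (1 / (a * ?\<pi>))"
        using a a\<pi> \<pi>pos unfolding sum_distrib_left[symmetric]
        by (intro mult_left_mono geometric_sum_le) auto
      then show ?thesis using False by simp
    qed (use \<pi> in simp)
    also have "\<dots> \<le> 1 / (1 / 2) ^ (?r + CARD('k))"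
      using lower by (intro divide_left_mono mult_pos_pos \<pi>pos) auto
    also have "\<dots> = 2 ^ CARD('k) * 2 ^ ?r" by (simp add: power_add power_one_over)
    also have "\<dots> \<le> 2 ^ CARD('k) * (2 ^ ?r * (2 * \<rho> ^ ?r))"
    proof -
      have "\<rho> ^ N \<le> \<rho> ^ ?r" using True \<rho> by (intro power_decreasing) auto
      then have "1 \<le> 2 * \<rho> ^ ?r" using \<rho>N by simp
      then show ?thesis by simp
    qed
    also have "\<dots> = (2 * 2 ^ CARD('k)) * (2 * \<rho>) ^ ?r" by (simp add: power_mult_distrib)
    finally show ?thesis .
  qed
  then have "ennreal ?L \<le> ennreal (2 * 2 ^ CARD('k)) * ennreal ((2 * \<rho>) ^ ?r)"
    using \<rho> by (subst ennreal_mult[symmetric]) (auto intro!: ennreal_leI)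
  also have "\<dots> \<le> ennreal (2 * 2 ^ CARD('k)) * (\<Prod>i\<in>UNIV. dyadic_weight N (v i))"
    by (intro mult_left_mono W) simp
  finally show ?thesis .
qed

section \<open>Linear separators and measurability\<close>

definition aff :: "real \<times> (real ^ 'k) \<Rightarrow> real ^ 'k \<Rightarrow> real" where
  "aff \<theta> x = fst \<theta> + x \<bullet> snd \<theta>"

definition sep :: "real \<times> (real ^ 'k) \<Rightarrow> real ^ 'k \<Rightarrow> int" where
  "sep \<theta> x = sign_label (aff \<theta> x)"

lemma sep_values: "sep \<theta> x = 1 \<or> sep \<theta> x = -1"
  by (simp add: sep_def sign_label_def)

text \<open>Division by the norm of a nonzero normal vector does not change signs, and the zero
  vector yields the constants. So the parameters range over a whole Euclidean space, without a
  constraint on the norm.\<close>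

lemma linear_separators_eq: "linear_separators = range sep"
proof
  show "linear_separators \<subseteq> range (sep :: real \<times> (real ^ 'a) \<Rightarrow> _)"
  proof
    fix h :: "real ^ 'a \<Rightarrow> int" assume "h \<in> linear_separators"
    then consider b w where "h = (\<lambda>x. sign_label (b + (\<Sum>i\<in>UNIV. x $ i * w $ i)))"
      | "h = (\<lambda>x. -1)" | "h = (\<lambda>x. 1)"
      by (auto simp: linear_separators_def)
    then show "h \<in> range sep"
    proof cases
      case (1 b w)
      then have "h = sep (b, w)" by (auto simp: sep_def aff_def inner_vec_def)
      then show ?thesis by simp
    next
      case 2
      then have "h = sep (-1, 0)" by (auto simp: sep_def aff_def sign_label_def)
      then show ?thesis by simp
    next
      case 3
      then have "h = sep (1, 0)" by (auto simp: sep_def aff_def sign_label_def)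
      then show ?thesis by simp
    qed
  qed
  show "range (sep :: real \<times> (real ^ 'a) \<Rightarrow> _) \<subseteq> linear_separators"
  proof clarify
    fix b :: real and w :: "real ^ 'a"
    show "sep (b, w) \<in> linear_separators"
    proof (cases "w = 0")
      case True
      then have "sep (b, w) = (\<lambda>x. -1) \<or> sep (b, w) = (\<lambda>x. 1)"
        by (auto simp: sep_def aff_def sign_label_def fun_eq_iff)
      then show ?thesis by (auto simp: linear_separators_def)
    next
      case False
      let ?n = "norm w"
      have n: "?n > 0" using False by simp
      have "sep (b, w) = (\<lambda>x. sign_label (b / ?n + (\<Sum>i\<in>UNIV. x $ i * (w /\<^sub>R ?n) $ i)))"
      proof
        fix x
        have "b / ?n + (\<Sum>i\<in>UNIV. x $ i * (w /\<^sub>R ?n) $ i) = aff (b, w) x / ?n"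
          by (simp add: aff_def inner_vec_def divide_inverse distrib_left sum_distrib_left mult_ac)
        then show "sep (b, w) x = sign_label (b / ?n + (\<Sum>i\<in>UNIV. x $ i * (w /\<^sub>R ?n) $ i))"
          using n by (simp add: sep_def sign_label_def zero_le_divide_iff)
      qed
      moreover have "(\<Sum>i\<in>UNIV. ((w /\<^sub>R ?n) $ i)\<^sup>2) = (norm (w /\<^sub>R ?n))\<^sup>2"
        by (simp add: norm_vec_def L2_set_def sum_nonneg)
      then have "(\<Sum>i\<in>UNIV. ((w /\<^sub>R ?n) $ i)\<^sup>2) = 1" using n by simp
      ultimately show ?thesis unfolding linear_separators_def by blast
    qed
  qed
qed

lemma aff_measurable [measurable]: "aff \<theta> \<in> borel_measurable borel"
  unfolding aff_def[abs_def] by measurable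

lemma sep_measurable [measurable]: "sep \<theta> \<in> borel \<rightarrow>\<^sub>M count_space UNIV"
  unfolding sep_def[abs_def] sign_label_def by measurable

text \<open>Unlike consistency, strict consistency is an open condition on the parameter, so that a
  countable dense set of parameters decides whether it is satisfiable.\<close>

definition strictly_consistent :: "real \<times> (real ^ 'k) \<Rightarrow> ((real ^ 'k) \<times> int) set \<Rightarrow> bool" where
  "strictly_consistent \<theta> A \<longleftrightarrow> (\<forall>z\<in>A. 0 < real_of_int (snd z) * aff \<theta> (fst z))"

lemma VS_eq: "VS F A = {h \<in> F. \<forall>z\<in>A. h (fst z) = snd z}"
  by (auto simp: VS_def)

lemma mem_VS_iff: "sep \<theta> \<in> VS linear_separators A \<longleftrightarrow> (\<forall>z\<in>A. sep \<theta> (fst z) = snd z)"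
  by (auto simp: VS_eq linear_separators_eq)

lemma VS_obtain:
  assumes "h \<in> VS linear_separators A"
  obtains \<theta> where "h = sep \<theta>"
  using assms by (auto simp: VS_def linear_separators_eq)

lemma strictly_consistent_imp_VS:
  assumes "strictly_consistent \<theta> A" "A \<subseteq> UNIV \<times> {-1, 1}"
  shows "sep \<theta> \<in> VS linear_separators A"
  unfolding mem_VS_iff
proof
  fix z assume z: "z \<in> A"
  then have "0 < real_of_int (snd z) * aff \<theta> (fst z)" "snd z = -1 \<or> snd z = 1"
    using assms by (auto simp: strictly_consistent_def)
  then show "sep \<theta> (fst z) = snd z" by (auto simp: sep_def sign_label_def)
qed

text \<open>Ties count as positive. A slightly larger bias makes points on the hyperplane strictly
  positive and leaves any finite set of negative points negative, which turns consistency into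
  strict consistency.\<close>

abbreviation raise_bias :: "real \<times> (real ^ 'k) \<Rightarrow> nat \<Rightarrow> real \<times> (real ^ 'k)" where
  "raise_bias \<theta> j \<equiv> (fst \<theta> + inverse (real (Suc j)), snd \<theta>)"

lemma aff_shift: "aff (raise_bias \<theta> j) x = aff \<theta> x + inverse (real (Suc j))"
  by (simp add: aff_def)

lemma aff_shift_eventually_neg:
  assumes "aff \<theta> x < 0" shows "\<forall>\<^sub>F j in sequentially. aff (raise_bias \<theta> j) x < 0"
proof -
  have "(\<lambda>j. aff \<theta> x + inverse (real (Suc j))) \<longlonglongrightarrow> aff \<theta> x + 0"
    by (intro tendsto_intros LIMSEQ_inverse_real_of_nat)
  then show ?thesis unfolding aff_shift using assms by (auto dest: order_tendstoD)
qed

lemma sep_shift_eventually: "\<forall>\<^sub>F j in sequentially. sep (raise_bias \<theta> j) x = sep \<theta> x"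
proof (cases "aff \<theta> x < 0")
  case True
  from aff_shift_eventually_neg[OF this] show ?thesis
    by eventually_elim (use True in \<open>simp add: sep_def sign_label_def\<close>)
next
  case False
  then have "aff (raise_bias \<theta> j) x \<ge> 0" for j unfolding aff_shift by (simp add: add_nonneg_nonneg)
  then show ?thesis using False by (simp add: sep_def sign_label_def)
qed

lemma shift_strictly_consistent:
  assumes A: "finite A" and \<theta>: "sep \<theta> \<in> VS linear_separators A"
  shows "\<forall>\<^sub>F j in sequentially. strictly_consistent (raise_bias \<theta> j) A"
  unfolding strictly_consistent_def
proof (rule eventually_ball_finite[OF A], rule ballI)
  fix z assume "z \<in> A"
  then have eq: "sep \<theta> (fst z) = snd z" using \<theta> by (auto simp: mem_VS_iff)
  show "\<forall>\<^sub>F j in sequentially. 0 < real_of_int (snd z) * aff (raise_bias \<theta> j) (fst z)"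
  proof (cases "aff \<theta> (fst z) < 0")
    case True
    then have "snd z = -1" using eq by (auto simp: sep_def sign_label_def)
    with aff_shift_eventually_neg[OF True] show ?thesis by simp
  next
    case False
    then have "snd z = 1" using eq by (auto simp: sep_def sign_label_def)
    moreover have "0 < aff (raise_bias \<theta> j) (fst z)" for j
      unfolding aff_shift using False by (simp add: add_nonneg_pos)
    ultimately show ?thesis by simp
  qed
qed

lemma VS_nonempty_iff:
  assumes "finite A" "A \<subseteq> UNIV \<times> {-1, 1}"
  shows "VS linear_separators A \<noteq> {} \<longleftrightarrow> (\<exists>\<theta>. strictly_consistent \<theta> A)"
proof
  assume "VS linear_separators A \<noteq> {}"
  then obtain \<theta> where "sep \<theta> \<in> VS linear_separators A" by (metis VS_obtain ex_in_conv)
  from eventually_happens[OF shift_strictly_consistent[OF assms(1) this]]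
  show "\<exists>\<theta>. strictly_consistent \<theta> A" by auto
qed (use strictly_consistent_imp_VS[OF _ assms(2)] in auto)

text \<open>Reduces disagreement at \<open>x\<close> to the satisfiability of two extended samples,
  a form in which measurability can be proved.\<close>

lemma DIS_VS_iff:
  "x \<in> DIS (VS linear_separators A) \<longleftrightarrow>
    VS linear_separators (insert (x, 1) A) \<noteq> {} \<and> VS linear_separators (insert (x, -1) A) \<noteq> {}"
proof
  assume "x \<in> DIS (VS linear_separators A)"
  then obtain h g where hg: "h \<in> VS linear_separators A" "g \<in> VS linear_separators A" "h x \<noteq> g x"
    by (auto simp: DIS_def)
  obtain \<theta> \<theta>' where "h = sep \<theta>" "g = sep \<theta>'" using hg by (auto elim!: VS_obtain)
  then have "(h x = 1 \<and> g x = -1) \<or> (h x = -1 \<and> g x = 1)"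
    using hg(3) sep_values[of \<theta> x] sep_values[of \<theta>' x] by auto
  then show "VS linear_separators (insert (x, 1) A) \<noteq> {} \<and> VS linear_separators (insert (x, -1) A) \<noteq> {}"
    using hg(1,2) by (auto simp: VS_def)
next
  assume "VS linear_separators (insert (x, 1) A) \<noteq> {} \<and> VS linear_separators (insert (x, -1) A) \<noteq> {}"
  then obtain h g where "h \<in> VS linear_separators (insert (x, 1) A)" "g \<in> VS linear_separators (insert (x, -1) A)"
    by auto
  then show "x \<in> DIS (VS linear_separators A)"
    unfolding DIS_def by (intro CollectI bexI[of _ h] bexI[of _ g]) (auto simp: VS_def)
qed

lemma VS_antimono: "A \<subseteq> B \<Longrightarrow> VS F B \<subseteq> VS F A"
  by (auto simp: VS_def)

lemma DIS_mono: "H \<subseteq> H' \<Longrightarrow> DIS H \<subseteq> DIS H'"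
  by (auto simp: DIS_def)

text \<open>Every subset of a Euclidean space has a countable dense subset, and the parameters
  strictly consistent with a finite sample form an open set. Hence \<open>E\<close> can be
  arbitrary; later it is the set of parameters with large error.\<close>

lemma strictly_consistent_event:
  fixes E :: "(real \<times> (real ^ 'k)) set"
  assumes J: "finite J" and Z: "\<And>i. i \<in> J \<Longrightarrow> Z i \<in> N \<rightarrow>\<^sub>M borel \<Otimes>\<^sub>M label_space"
  shows "{\<omega> \<in> space N. \<exists>\<theta>\<in>E. strictly_consistent \<theta> ((\<lambda>i. Z i \<omega>) ` J)} \<in> sets N"
proof -
  obtain E' where E': "countable E'" "E' \<subseteq> E" "E \<subseteq> closure E'" by (rule separable)
  have "(\<exists>\<theta>\<in>E. strictly_consistent \<theta> ((\<lambda>i. Z i \<omega>) ` J)) \<longleftrightarrow> (\<exists>\<theta>\<in>E'. \<forall>i\<in>J. 0 < real_of_int (snd (Z i \<omega>)) * aff \<theta> (fst (Z i \<omega>)))" for \<omega>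
  proof
    assume "\<exists>\<theta>\<in>E. strictly_consistent \<theta> ((\<lambda>i. Z i \<omega>) ` J)"
    then obtain \<theta> where \<theta>: "\<theta> \<in> E" "\<And>i. i \<in> J \<Longrightarrow> 0 < real_of_int (snd (Z i \<omega>)) * aff \<theta> (fst (Z i \<omega>))"
      by (auto simp: strictly_consistent_def)
    let ?O = "\<Inter>i\<in>J. {\<theta>. 0 < real_of_int (snd (Z i \<omega>)) * aff \<theta> (fst (Z i \<omega>))}"
    have O: "open ?O" using J
      unfolding aff_def by (intro open_INT ballI open_Collect_less continuous_intros)
    have "\<theta> \<in> ?O \<inter> closure E'" using \<theta> E'(3) by blast
    then have "?O \<inter> E' \<noteq> {}"
      unfolding open_Int_closure_eq_empty[OF O, of E', symmetric] by blast
    then show "\<exists>\<theta>\<in>E'. \<forall>i\<in>J. 0 < real_of_int (snd (Z i \<omega>)) * aff \<theta> (fst (Z i \<omega>))" by auto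
  qed (use E'(2) in \<open>auto simp: strictly_consistent_def\<close>)
  moreover have "{\<omega> \<in> space N. \<exists>\<theta>\<in>E'. \<forall>i\<in>J. 0 < real_of_int (snd (Z i \<omega>)) * aff \<theta> (fst (Z i \<omega>))} \<in> sets N"
  proof -
    have "Measurable.pred N (\<lambda>\<omega>. 0 < real_of_int (snd (Z i \<omega>)) * aff \<theta> (fst (Z i \<omega>)))" if "i \<in> J" for i \<theta>
    proof -
      note [measurable] = Z[OF that]
      have [measurable]: "real_of_int \<in> borel_measurable label_space"
        by (simp add: label_space_def)
      show ?thesis by measurable
    qed
    then have "{\<omega> \<in> space N. \<forall>i\<in>J. 0 < real_of_int (snd (Z i \<omega>)) * aff \<theta> (fst (Z i \<omega>))} \<in> sets N" for \<theta>
      using J by (intro sets.sets_Collect_finite_All) (auto simp: pred_def)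
    then have "(\<Union>\<theta>\<in>E'. {\<omega> \<in> space N. \<forall>i\<in>J. 0 < real_of_int (snd (Z i \<omega>)) * aff \<theta> (fst (Z i \<omega>))}) \<in> sets N"
      using E'(1) by (intro sets.countable_UN') auto
    moreover have "(\<Union>\<theta>\<in>E'. {\<omega> \<in> space N. \<forall>i\<in>J. 0 < real_of_int (snd (Z i \<omega>)) * aff \<theta> (fst (Z i \<omega>))})
      = {\<omega> \<in> space N. \<exists>\<theta>\<in>E'. \<forall>i\<in>J. 0 < real_of_int (snd (Z i \<omega>)) * aff \<theta> (fst (Z i \<omega>))}"
      by blast
    ultimately show ?thesis by simp
  qed
  ultimately show ?thesis by simp
qed

section \<open>Measurability for a realizable distribution\<close>

locale realizable_separator = prob_space P for P :: "((real ^ 'k) \<times> int) measure" +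
  fixes \<theta>\<^sub>0 :: "real \<times> (real ^ 'k)"
  assumes sets_P [measurable_cong]: "sets P = sets (borel \<Otimes>\<^sub>M label_space)"
    and labels: "AE z in P. snd z = sep \<theta>\<^sub>0 (fst z)"
begin

abbreviation "F \<equiv> (linear_separators :: (real ^ 'k \<Rightarrow> int) set)"

lemma space_P: "space P = UNIV \<times> {-1, 1}"
  using sets_eq_imp_space_eq[OF sets_P] by (simp add: space_pair_measure label_space_def)

lemma sample_labels: "S \<in> space (PiM J (\<lambda>_. P)) \<Longrightarrow> S ` J \<subseteq> UNIV \<times> {-1, 1}"
  by (auto simp: space_PiM space_P[symmetric])

sublocale disagreement_region P "\<lambda>A. {z. fst z \<in> DIS (VS F A)}"
proof
  show "{z. fst z \<in> DIS (VS F B)} \<subseteq> {z. fst z \<in> DIS (VS F A)}" if "A \<subseteq> B" for A B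
    using DIS_mono[OF VS_antimono[OF that]] by auto
  fix J :: "nat set" assume J: "finite J"
  let ?N = "PiM J (\<lambda>_. P) \<Otimes>\<^sub>M P"
  have *: "{p \<in> space ?N. VS F (insert (fst (snd p), y) (fst p ` J)) \<noteq> {}} \<in> sets ?N" if y: "y \<in> {-1, 1}" for y
  proof -
    \<comment> \<open>The index \<open>None\<close> stands for the fresh instance with the tentative
      label \<open>y\<close>.\<close>
    let ?Z = "\<lambda>i p. case i of None \<Rightarrow> (fst (snd p), y) | Some i \<Rightarrow> fst p i"
    let ?K = "insert None (Some ` J)"
    have img: "(\<lambda>i. ?Z i p) ` ?K = insert (fst (snd p), y) (fst p ` J)" for p :: "(nat \<Rightarrow> (real ^ 'k) \<times> int) \<times> (real ^ 'k) \<times> int"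
      by (auto simp: image_image)
    have "?Z i \<in> ?N \<rightarrow>\<^sub>M borel \<Otimes>\<^sub>M label_space" if "i \<in> ?K" for i
    proof (cases i)
      case None
      have "y \<in> space label_space" using y by (simp add: label_space_def)
      then have "(\<lambda>p. (fst (snd p), y)) \<in> ?N \<rightarrow>\<^sub>M borel \<Otimes>\<^sub>M label_space" by measurable
      then show ?thesis by (simp add: None)
    next
      case (Some j)
      then have "j \<in> J" using that by auto
      then have "(\<lambda>p. fst p j) \<in> ?N \<rightarrow>\<^sub>M P" by measurable
      then show ?thesis by (simp add: Some measurable_cong_sets[OF refl sets_P])
    qed
    then have "{p \<in> space ?N. \<exists>\<theta>\<in>UNIV. strictly_consistent \<theta> ((\<lambda>i. ?Z i p) ` ?K)} \<in> sets ?N"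
      using J by (intro strictly_consistent_event) auto
    also have "{p \<in> space ?N. \<exists>\<theta>\<in>UNIV. strictly_consistent \<theta> ((\<lambda>i. ?Z i p) ` ?K)}
        = {p \<in> space ?N. VS F (insert (fst (snd p), y) (fst p ` J)) \<noteq> {}}"
    proof -
      have "insert (fst (snd p), y) (fst p ` J) \<subseteq> UNIV \<times> {-1, 1}" if "p \<in> space ?N" for p
        using that y sample_labels[of "fst p" J] unfolding space_pair_measure
        by (intro insert_subsetI) (simp_all add: mem_Times_iff)
      from VS_nonempty_iff[OF _ this]
      have "(\<exists>\<theta>\<in>UNIV. strictly_consistent \<theta> (insert (fst (snd p), y) (fst p ` J)))
          \<longleftrightarrow> VS F (insert (fst (snd p), y) (fst p ` J)) \<noteq> {}" if "p \<in> space ?N" for p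
        using that J by simp
      then show ?thesis unfolding img by (intro Collect_cong conj_cong refl)
    qed
    finally show ?thesis .
  qed
  have "{p \<in> space ?N. snd p \<in> {z. fst z \<in> DIS (VS F (fst p ` J))}}
      = {p \<in> space ?N. VS F (insert (fst (snd p), 1) (fst p ` J)) \<noteq> {}}
        \<inter> {p \<in> space ?N. VS F (insert (fst (snd p), -1) (fst p ` J)) \<noteq> {}}"
    by (auto simp: DIS_VS_iff)
  also have "\<dots> \<in> sets ?N" by (intro sets.Int *) auto
  finally show "{p \<in> space ?N. snd p \<in> {z. fst z \<in> DIS (VS F (fst p ` J))}} \<in> sets ?N" .
qed

lemma error_event [measurable]: "{z \<in> space P. sep \<theta> (fst z) \<noteq> snd z} \<in> sets P"
proof -
  have [measurable]: "snd \<in> P \<rightarrow>\<^sub>M count_space UNIV"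
  proof -
    have "(\<lambda>z. id (snd z)) \<in> P \<rightarrow>\<^sub>M count_space UNIV"
      by (rule measurable_compose[of snd P label_space]) (measurable, simp add: label_space_def)
    then show ?thesis by simp
  qed
  show ?thesis by measurable
qed

text \<open>The prediction at each instance is eventually unchanged, so dominated convergence
  applies. Consequently a strict excess of the error over \<epsilon> survives a small raise of the
  bias.\<close>

lemma er_shift: "(\<lambda>j. er P (sep (raise_bias \<theta> j))) \<longlonglongrightarrow> er P (sep \<theta>)"
proof -
  let ?D = "\<lambda>\<theta>. {z \<in> space P. sep \<theta> (fst z) \<noteq> snd z}"
  have "(\<lambda>j. (\<integral>z. indicator (?D (raise_bias \<theta> j)) z \<partial>P) :: real) \<longlonglongrightarrow> (\<integral>z. indicator (?D \<theta>) z \<partial>P)"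
  proof (rule integral_dominated_convergence[where w = "\<lambda>_. 1"])
    show "AE z in P. (\<lambda>j. indicator (?D (raise_bias \<theta> j)) z :: real) \<longlonglongrightarrow> indicator (?D \<theta>) z"
    proof (rule AE_I2, rule tendsto_eventually)
      show "\<forall>\<^sub>F j in sequentially. indicator (?D (raise_bias \<theta> j)) z = (indicator (?D \<theta>) z :: real)" for z
        using sep_shift_eventually[of \<theta> "fst z"] by eventually_elim (simp add: indicator_def)
    qed
  qed (auto simp: indicator_def intro!: borel_measurable_indicator)
  then show ?thesis by (simp add: er_def)
qed

abbreviation large_error :: "real \<Rightarrow> (nat \<Rightarrow> (real ^ 'k) \<times> int) \<Rightarrow> nat \<Rightarrow> bool" where
  "large_error \<epsilon> S m \<equiv> \<exists>h\<in>VS F (S ` {..<m}). \<epsilon> < er P h"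

lemma large_error_iff:
  assumes "S \<in> space \<Omega>"
  shows "large_error \<epsilon> S m \<longleftrightarrow> (\<exists>\<theta>\<in>{\<theta>. \<epsilon> < er P (sep \<theta>)}. strictly_consistent \<theta> (S ` {..<m}))"
proof
  assume "large_error \<epsilon> S m"
  then obtain \<theta> where \<theta>: "sep \<theta> \<in> VS F (S ` {..<m})" "\<epsilon> < er P (sep \<theta>)" by (metis VS_obtain)
  have "\<forall>\<^sub>F j in sequentially. \<epsilon> < er P (sep (raise_bias \<theta> j)) \<and> strictly_consistent (raise_bias \<theta> j) (S ` {..<m})"
    using order_tendstoD(1)[OF er_shift \<theta>(2)] shift_strictly_consistent[OF _ \<theta>(1)]
    by (auto intro: eventually_conj)
  from eventually_happens[OF this]
  show "\<exists>\<theta>\<in>{\<theta>. \<epsilon> < er P (sep \<theta>)}. strictly_consistent \<theta> (S ` {..<m})" by auto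
next
  assume "\<exists>\<theta>\<in>{\<theta>. \<epsilon> < er P (sep \<theta>)}. strictly_consistent \<theta> (S ` {..<m})"
  moreover have "S ` {..<m} \<subseteq> UNIV \<times> {-1, 1}" using assms sample_labels[of S UNIV] by auto
  ultimately show "large_error \<epsilon> S m" using strictly_consistent_imp_VS by blast
qed

lemma large_error_measurable [measurable]: "Measurable.pred \<Omega> (\<lambda>S. large_error \<epsilon> S m)"
proof -
  have "{S \<in> space \<Omega>. \<exists>\<theta>\<in>{\<theta>. \<epsilon> < er P (sep \<theta>)}. strictly_consistent \<theta> ((\<lambda>i. S i) ` {..<m})} \<in> sets \<Omega>"
    by (rule strictly_consistent_event) (auto simp: measurable_cong_sets[OF refl sets_P[symmetric]])
  then show ?thesis by (simp add: pred_def large_error_iff cong: conj_cong)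
qed

end

section \<open>Request counts and the time at which the budget is spent\<close>

lemma sample_enat: "sample S (enat m) = S ` {..<m}"
  by (auto simp: sample_def)

lemma sample_infinity: "sample S \<infinity> = range S"
  by (auto simp: sample_def)

lemma num_labels_Suc: "num_labels F S (Suc m) = num_labels F S m + of_bool (fst (S m) \<in> DIS (VS F (S ` {..<m})))"
  by (simp add: num_labels_def sample_enat)

lemma num_labels_mono: "m \<le> m' \<Longrightarrow> num_labels F S m \<le> num_labels F S m'"
  by (rule lift_Suc_mono_le[of "num_labels F S"]) (simp_all add: num_labels_Suc)

lemma label_time_eq_enat:
  "label_time F S n = enat m \<longleftrightarrow> num_labels F S m = n \<and> (\<forall>m'<m. num_labels F S m' \<noteq> n)"
proof
  assume lt: "label_time F S n = enat m"
  then have "{m. num_labels F S m = n} \<noteq> {}" by (intro notI) (simp add: label_time_def top_enat_def)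
  then have "enat m \<in> enat ` {m. num_labels F S m = n}"
    using lt unfolding label_time_def by (metis Inf_enat_def LeastI_ex empty_is_image ex_in_conv)
  moreover have "num_labels F S m' \<noteq> n" if "m' < m" for m'
  proof
    assume "num_labels F S m' = n"
    then have "label_time F S n \<le> enat m'" unfolding label_time_def by (intro Inf_lower) auto
    then show False using lt that by simp
  qed
  ultimately show "num_labels F S m = n \<and> (\<forall>m'<m. num_labels F S m' \<noteq> n)" by auto
next
  assume *: "num_labels F S m = n \<and> (\<forall>m'<m. num_labels F S m' \<noteq> n)"
  show "label_time F S n = enat m"
    unfolding label_time_def
  proof (rule antisym)
    show "Inf (enat ` {m. num_labels F S m = n}) \<le> enat m" using * by (intro Inf_lower) auto
    show "enat m \<le> Inf (enat ` {m. num_labels F S m = n})"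
      using * by (intro Inf_greatest) (auto simp: not_less[symmetric])
  qed
qed

lemma label_time_eq_infinity: "label_time F S n = \<infinity> \<longleftrightarrow> (\<forall>m. num_labels F S m \<noteq> n)"
proof
  assume "label_time F S n = \<infinity>"
  moreover have "label_time F S n \<le> enat m" if "num_labels F S m = n" for m
    unfolding label_time_def using that by (intro Inf_lower) auto
  ultimately show "\<forall>m. num_labels F S m \<noteq> n" by auto
qed (auto simp: label_time_def top_enat_def)

text \<open>If the budget is never exhausted, then the requests stop at some time; from then on the
  version space does not change unless it becomes empty.\<close>

lemma VS_infinite_time:
  assumes lt: "label_time F S n = \<infinity>" and ne: "\<And>m. VS F (S ` {..<m}) \<noteq> {}"
  obtains m where "VS F (range S) = VS F (S ` {..<m})"
proof -
  have neq: "num_labels F S m \<noteq> n" for m using lt by (simp add: label_time_eq_infinity)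
  \<comment> \<open>The count starts at 0 and grows by at most 1, so it cannot pass \<open>n\<close>
    without attaining it.\<close>
  have lt: "num_labels F S m < n" for m
  proof (induction m)
    case 0 then show ?case using neq[of 0] by (simp add: num_labels_def)
  next
    case (Suc m) then show ?case using neq[of "Suc m"] by (auto simp: num_labels_Suc split: if_splits)
  qed
  then obtain m\<^sub>0 where m\<^sub>0: "\<And>m. num_labels F S m \<le> num_labels F S m\<^sub>0"
    using ex_has_greatest_nat[of "\<lambda>_. True" 0 "num_labels F S" n] by (auto intro: less_imp_le)
  have quiet: "fst (S m) \<notin> DIS (VS F (S ` {..<m}))" if "m\<^sub>0 \<le> m" for m
    using m\<^sub>0[of "Suc m"] num_labels_mono[OF that, of F S] by (auto simp: num_labels_Suc)
  have eq: "VS F (S ` {..<m}) = VS F (S ` {..<m\<^sub>0})" if "m\<^sub>0 \<le> m" for m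
    using that
  proof (induction m rule: dec_induct)
    case (step m)
    \<comment> \<open>A member of the next version space predicts the new label correctly; as there
      is no disagreement at this instance, all members of the current one do too.\<close>
    obtain g where g: "g \<in> VS F (S ` {..<Suc m})" using ne by blast
    then have g': "g \<in> VS F (S ` {..<m})" "g (fst (S m)) = snd (S m)"
      by (auto simp: VS_eq lessThan_Suc)
    have "h (fst (S m)) = snd (S m)" if "h \<in> VS F (S ` {..<m})" for h
    proof -
      have "h (fst (S m)) = g (fst (S m))"
        using quiet[OF step(1)] that g'(1) unfolding DIS_def by blast
      then show ?thesis using g'(2) by simp
    qed
    then have "VS F (S ` {..<Suc m}) = VS F (S ` {..<m})"
      by (auto simp: VS_eq lessThan_Suc)
    with step show ?case by simp
  qed simp
  have "VS F (range S) = VS F (S ` {..<m\<^sub>0})"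
  proof
    show "VS F (range S) \<subseteq> VS F (S ` {..<m\<^sub>0})" by (rule VS_antimono) auto
    show "VS F (S ` {..<m\<^sub>0}) \<subseteq> VS F (range S)"
    proof
      fix h assume h: "h \<in> VS F (S ` {..<m\<^sub>0})"
      have "h (fst (S i)) = snd (S i)" for i
      proof -
        have "h \<in> VS F (S ` {..<max m\<^sub>0 (Suc i)})" using h eq[of "max m\<^sub>0 (Suc i)"] by simp
        moreover have "S i \<in> S ` {..<max m\<^sub>0 (Suc i)}" by auto
        ultimately show ?thesis by (auto simp: VS_eq)
      qed
      moreover have "h \<in> F" using h by (simp add: VS_def)
      ultimately show "h \<in> VS F (range S)" by (auto simp: VS_eq)
    qed
  qed
  then show thesis by (rule that)
qed

context realizable_separator
begin

lemma num_labels_measurable [measurable]: "(\<lambda>S. num_labels F S m) \<in> \<Omega> \<rightarrow>\<^sub>M count_space UNIV"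
proof -
  have [measurable]: "Measurable.pred \<Omega> (\<lambda>S. fst (S i) \<in> DIS (VS F (S ` {..<i})))" for i
    using hits_measurable[of "{..<i}" i] by simp
  show ?thesis unfolding num_labels_def sample_enat of_bool_def by measurable
qed

text \<open>Measurability is needed for this very set: the measure of a non-measurable set is 0, no
  matter how large a measurable set it contains.\<close>

lemma success_event:
  "{S \<in> space \<Omega>. (SUP h\<in>VS F (sample S (label_time F S n)). ereal (er P h)) \<le> ereal \<epsilon>} \<in> sets \<Omega>"
proof -
  have le: "(SUP h\<in>A. ereal (er P h)) \<le> ereal \<epsilon> \<longleftrightarrow> \<not> (\<exists>h\<in>A. \<epsilon> < er P h)" for A
    by (simp add: SUP_le_iff not_less)
  \<comment> \<open>Failure is written without \<open>label_time\<close>, by countable quantifiers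
    over finite samples: either the budget is first spent at some \<open>m\<close> with large error,
    or it is never spent and the error is large at every \<open>m\<close>.\<close>
  have eq: "(SUP h\<in>VS F (sample S (label_time F S n)). ereal (er P h)) \<le> ereal \<epsilon> \<longleftrightarrow>
     \<not> ((\<exists>m. num_labels F S m = n \<and> (\<forall>m'<m. num_labels F S m' \<noteq> n) \<and> large_error \<epsilon> S m)
       \<or> ((\<forall>m. num_labels F S m \<noteq> n) \<and> (\<forall>m. large_error \<epsilon> S m)))" for S
  proof (cases "label_time F S n")
    case (enat m)
    then have m: "num_labels F S m = n" "\<forall>m'<m. num_labels F S m' \<noteq> n"
      by (auto simp: label_time_eq_enat)
    then have "m' = m" if "num_labels F S m' = n" "\<forall>m''<m'. num_labels F S m'' \<noteq> n" for m'
      using that by (metis linorder_neqE_nat)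
    with m have "(\<exists>m. num_labels F S m = n \<and> (\<forall>m'<m. num_labels F S m' \<noteq> n) \<and> large_error \<epsilon> S m)
        \<longleftrightarrow> large_error \<epsilon> S m" by blast
    then show ?thesis using m unfolding enat sample_enat le by blast
  next
    case infinity
    then have m: "\<forall>m. num_labels F S m \<noteq> n" by (simp add: label_time_eq_infinity)
    have "(\<exists>h\<in>VS F (range S). \<epsilon> < er P h) \<longleftrightarrow> (\<forall>m. large_error \<epsilon> S m)"
    proof
      assume "\<exists>h\<in>VS F (range S). \<epsilon> < er P h"
      moreover have "VS F (range S) \<subseteq> VS F (S ` {..<m})" for m by (rule VS_antimono) auto
      ultimately show "\<forall>m. large_error \<epsilon> S m" by blast
    next
      \<comment> \<open>Large error at every time also shows that no finite sample has an empty
        version space, as \<open>VS_infinite_time\<close> requires.\<close>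
      assume *: "\<forall>m. large_error \<epsilon> S m"
      then have "VS F (S ` {..<m}) \<noteq> {}" for m by blast
      from VS_infinite_time[OF infinity this] * show "\<exists>h\<in>VS F (range S). \<epsilon> < er P h" by metis
    qed
    then show ?thesis using m unfolding infinity sample_infinity le by blast
  qed
  show ?thesis unfolding eq by measurable
qed

end

section \<open>The expected disagreement mass\<close>

lemma borel_measurable_vec_nth: "(\<lambda>z :: real ^ 'k. z $ i) \<in> borel_measurable borel"
  by (intro borel_measurable_continuous_onI continuous_intros)

abbreviation axis_set :: "'k \<Rightarrow> real set \<Rightarrow> 'k \<Rightarrow> real set" where
  "axis_set i\<^sub>0 I i \<equiv> (if i = i\<^sub>0 then I else UNIV)"

text \<open>Each condition concerns a single coordinate, the one on \<open>I\<close> only the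
  coordinate \<open>i\<^sub>0\<close>, so the indicator of the set is a product over the
  coordinates.\<close>

lemma emeasure_orthant:
  fixes z :: "real ^ 'k"
  assumes [measurable]: "I \<in> sets borel"
  shows "emeasure std_gauss {y. (\<forall>i. 0 \<le> s i * (y $ i - z $ i)) \<and> (y $ i\<^sub>0 \<in> I \<longleftrightarrow> z $ i\<^sub>0 \<in> I)}
    = ennreal (\<Prod>i\<in>UNIV. orthant_mass (axis_set i\<^sub>0 I i) (s i) (z $ i))"
proof -
  interpret prob_space std_gauss1 by (rule prob_space_std_gauss1)
  let ?I = "axis_set i\<^sub>0 I"
  let ?A = "{y. (\<forall>i. 0 \<le> s i * (y $ i - z $ i)) \<and> (y $ i\<^sub>0 \<in> I \<longleftrightarrow> z $ i\<^sub>0 \<in> I)}"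
  let ?B = "\<lambda>i. {u. 0 \<le> s i * (u - z $ i) \<and> (u \<in> ?I i \<longleftrightarrow> z $ i \<in> ?I i)}"
  have I: "?I i \<in> sets borel" for i by simp
  have B: "?B i \<in> sets borel" for i
  proof -
    have "{u \<in> space borel. 0 \<le> s i * (u - z $ i) \<and> (u \<in> ?I i \<longleftrightarrow> z $ i \<in> ?I i)} \<in> sets borel"
      using I[of i] by measurable
    then show ?thesis by simp
  qed
  have prod_ind: "indicator ?A y = (\<Prod>i\<in>UNIV. indicator (?B i) (y $ i) :: ennreal)" for y
  proof (cases "y \<in> ?A")
    case True
    then have "y $ i \<in> ?B i" for i by auto
    then show ?thesis using True by simp
  next
    case False
    have "\<exists>i. y $ i \<notin> ?B i"
    proof (rule ccontr)
      assume "\<nexists>i. y $ i \<notin> ?B i"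
      then have *: "y $ i \<in> ?B i" for i by blast
      from this[of i\<^sub>0] this have "y \<in> ?A" by simp
      with False show False by simp
    qed
    then have "(\<Prod>i\<in>UNIV. indicator (?B i) (y $ i) :: ennreal) = 0"
      by (intro prod_zero) (auto simp: indicator_def)
    then show ?thesis using False by simp
  qed
  have "(\<lambda>y. \<Prod>i\<in>UNIV. indicator (?B i) (y $ i) :: ennreal) \<in> borel_measurable borel"
    using B by (intro borel_measurable_prod_ennreal measurable_compose[OF borel_measurable_vec_nth borel_measurable_indicator]) auto
  then have "?A \<in> sets borel"
    unfolding prod_ind[symmetric] by (simp add: borel_measurable_indicator_iff)
  then have "emeasure std_gauss ?A = (\<integral>\<^sup>+y. indicator ?A y \<partial>std_gauss)" by simp
  also have "\<dots> = (\<integral>\<^sup>+y. (\<Prod>i\<in>UNIV. indicator (?B i) (y $ i)) \<partial>std_gauss)"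
    unfolding prod_ind ..
  also have "\<dots> = (\<Prod>i\<in>UNIV. \<integral>\<^sup>+u. indicator (?B i) u \<partial>std_gauss1)"
    using B by (intro nn_integral_std_gauss_prod) simp
  also have "\<dots> = ennreal (\<Prod>i\<in>UNIV. orthant_mass (?I i) (s i) (z $ i))"
    using B by (simp add: orthant_mass_def emeasure_eq_measure prod_ennreal)
  finally show ?thesis .
qed

lemma nn_integral_orthant_sum_le:
  fixes s :: "'k::finite \<Rightarrow> real"
  assumes I: "I \<in> sets borel" and a: "0 \<le> a" "a \<le> 1" and N: "1 \<le> N"
  shows "(\<integral>\<^sup>+z. ennreal (\<Sum>m<2 ^ N. a * (1 - a * (\<Prod>i\<in>UNIV. orthant_mass (axis_set i\<^sub>0 I i) (s i) (z $ i))) ^ m) \<partial>std_gauss)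
    \<le> ennreal (2 * 2 ^ CARD('k) * (8 * real N) ^ CARD('k))"
proof -
  let ?o = "\<lambda>i. orthant_mass (axis_set i\<^sub>0 I i) (s i)"
  have Ii: "axis_set i\<^sub>0 I i \<in> sets borel" for i using I by simp
  have o: "?o i \<in> borel_measurable borel" for i by (rule orthant_mass_measurable[OF Ii])
  have W: "(\<lambda>u. dyadic_weight N (?o i u)) \<in> borel_measurable borel" for i
    by (rule measurable_compose[OF o dyadic_weight_measurable])
  have Wz: "(\<lambda>z. \<Prod>i\<in>UNIV. dyadic_weight N (?o i (z $ i))) \<in> borel_measurable std_gauss"
    unfolding measurable_cong_sets[OF sets_std_gauss refl]
    by (intro borel_measurable_prod_ennreal measurable_compose[OF borel_measurable_vec_nth W])
  have "(\<integral>\<^sup>+z. ennreal (\<Sum>m<2 ^ N. a * (1 - a * (\<Prod>i\<in>UNIV. ?o i (z $ i))) ^ m) \<partial>std_gauss)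
    \<le> (\<integral>\<^sup>+z. ennreal (2 * 2 ^ CARD('k)) * (\<Prod>i\<in>UNIV. dyadic_weight N (?o i (z $ i))) \<partial>std_gauss)"
    by (intro nn_integral_mono sum_le_prod_dyadic_weight a N orthant_mass_nonneg orthant_mass_le_1)
  also have "\<dots> = ennreal (2 * 2 ^ CARD('k)) * (\<integral>\<^sup>+z. (\<Prod>i\<in>UNIV. dyadic_weight N (?o i (z $ i))) \<partial>std_gauss)"
    by (rule nn_integral_cmult[OF Wz])
  also have "(\<integral>\<^sup>+z. (\<Prod>i\<in>UNIV. dyadic_weight N (?o i (z $ i))) \<partial>std_gauss)
      = (\<Prod>i\<in>UNIV. \<integral>\<^sup>+u. dyadic_weight N (?o i u) \<partial>std_gauss1)"
    by (rule nn_integral_std_gauss_prod[OF W])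
  also have "\<dots> \<le> (\<Prod>i\<in>(UNIV :: 'k set). ennreal (8 * real N))"
    by (intro prod_mono_ennreal nn_integral_dyadic_weight_le Ii N)
  also have "ennreal (2 * 2 ^ CARD('k)) * \<dots> = ennreal (2 * 2 ^ CARD('k) * (8 * real N) ^ CARD('k))"
    by (simp only: prod_constant ennreal_power ennreal_mult[symmetric] zero_le_power of_nat_0_le_iff
        mult_nonneg_nonneg zero_le_numeral)
  finally show ?thesis by (simp add: mult_left_mono)
qed

section \<open>Empty orthants and coordinates adapted to a component\<close>

definition signs :: "('k \<Rightarrow> real) set" where
  "signs = PiE UNIV (\<lambda>_. {-1, 1})"

lemma finite_signs [simp]: "finite (signs :: ('k::finite \<Rightarrow> real) set)"
  and card_signs: "card (signs :: ('k::finite \<Rightarrow> real) set) = 2 ^ CARD('k)"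
  by (auto simp: signs_def card_PiE numeral_2_eq_2 intro!: finite_PiE)

text \<open>A separator that errs at \<open>x\<close> but not on the sample has all sample points with the label of
  \<open>x\<close> on one side of the parallel hyperplane through \<open>x\<close>, so the closed orthant at \<open>x\<close> that lies
  on the other side contains none of them.\<close>

lemma DIS_empty_orthant:
  fixes T T' :: "real ^ 'k \<Rightarrow> real ^ 'k"
  assumes T: "\<And>v z z'. (T z - T z') \<bullet> v = (z - z') \<bullet> A v" "\<And>x. T (T' x) = x"
    and dis: "x \<in> DIS (VS linear_separators B)"
    and B: "\<And>z. z \<in> B \<Longrightarrow> snd z = sep \<theta>\<^sub>0 (fst z)"
  obtains s where "s \<in> signs" "\<And>z. z \<in> B \<Longrightarrow>
    \<not> ((\<forall>i. 0 \<le> s i * (T' (fst z) $ i - T' x $ i)) \<and> sep \<theta>\<^sub>0 (fst z) = sep \<theta>\<^sub>0 x)"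
proof -
  from dis obtain h g where hg: "h \<in> VS linear_separators B" "g \<in> VS linear_separators B" "h x \<noteq> g x"
    unfolding DIS_def by blast
  obtain \<theta>\<^sub>h where h: "h = sep \<theta>\<^sub>h" by (rule VS_obtain[OF hg(1)])
  obtain \<theta>\<^sub>g where g: "g = sep \<theta>\<^sub>g" by (rule VS_obtain[OF hg(2)])
  from hg(3) have "sep \<theta>\<^sub>h x \<noteq> sep \<theta>\<^sub>0 x \<or> sep \<theta>\<^sub>g x \<noteq> sep \<theta>\<^sub>0 x" unfolding h g by metis
  then obtain \<theta> where \<theta>: "sep \<theta> \<in> VS linear_separators B" "sep \<theta> x \<noteq> sep \<theta>\<^sub>0 x"
    using hg(1,2) unfolding h g by blast
  define \<sigma> where "\<sigma> = real_of_int (sep \<theta>\<^sub>0 x)"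
  define v where "v = A (snd \<theta>)"
  \<comment> \<open>The consistent separator gives \<open>z\<close> the target's label of
    \<open>x\<close> but gives \<open>x\<close> the opposite one, so its affine function changes in
    the direction \<open>\<sigma>\<close> from \<open>x\<close> to \<open>z\<close>.\<close>
  have pos: "0 < \<sigma> * ((T' (fst z) - T' x) \<bullet> v)" if z: "z \<in> B" "sep \<theta>\<^sub>0 (fst z) = sep \<theta>\<^sub>0 x" for z
  proof -
    have "sep \<theta> (fst z) = sep \<theta>\<^sub>0 x" using \<theta>(1) z B[OF z(1)] by (auto simp: mem_VS_iff)
    then have "0 < \<sigma> * (aff \<theta> (fst z) - aff \<theta> x)"
      using \<theta>(2) unfolding \<sigma>_def sep_def sign_label_def by (auto split: if_splits)
    also have "aff \<theta> (fst z) - aff \<theta> x = (T (T' (fst z)) - T (T' x)) \<bullet> snd \<theta>"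
      by (simp add: aff_def T(2) inner_diff_left)
    finally show ?thesis by (simp only: T(1) v_def)
  qed
  \<comment> \<open>Along each axis the orthant points against \<open>\<sigma> * v $ i\<close>;
    where this vanishes, either sign works.\<close>
  define s where "s i = (if 0 < \<sigma> * v $ i then -1 else 1 :: real)" for i
  show thesis
  proof (rule that)
    show "s \<in> signs" by (auto simp: signs_def s_def)
    fix z assume z: "z \<in> B"
    show "\<not> ((\<forall>i. 0 \<le> s i * (T' (fst z) $ i - T' x $ i)) \<and> sep \<theta>\<^sub>0 (fst z) = sep \<theta>\<^sub>0 x)"
    proof
      assume *: "(\<forall>i. 0 \<le> s i * (T' (fst z) $ i - T' x $ i)) \<and> sep \<theta>\<^sub>0 (fst z) = sep \<theta>\<^sub>0 x"
      have "\<sigma> * ((T' (fst z) - T' x) \<bullet> v) = (\<Sum>i\<in>UNIV. (T' (fst z) $ i - T' x $ i) * (\<sigma> * v $ i))"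
        by (simp add: inner_vec_def sum_distrib_left mult_ac)
      also have "\<dots> \<le> 0"
      proof (rule sum_nonpos)
        fix i
        have "0 \<le> s i * (T' (fst z) $ i - T' x $ i)" using * by simp
        then show "(T' (fst z) $ i - T' x $ i) * (\<sigma> * v $ i) \<le> 0"
          by (auto simp: s_def mult_nonpos_nonneg mult_nonneg_nonpos split: if_splits)
      qed
      finally show False using pos[OF z] * by simp
    qed
  qed
qed

lemma nn_integral_mixture:
  fixes p :: "nat \<Rightarrow> ennreal"
  assumes D: "sets D = sets borel" and \<nu>: "\<And>j. j < t \<Longrightarrow> sets (\<nu> j) = sets borel"
    and eq: "\<And>A. A \<in> sets borel \<Longrightarrow> emeasure D A = (\<Sum>j<t. p j * emeasure (\<nu> j) A)"
    and f: "f \<in> borel_measurable borel"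
  shows "(\<integral>\<^sup>+x. f x \<partial>D) = (\<Sum>j<t. p j * (\<integral>\<^sup>+x. f x \<partial>\<nu> j))"
  using f
proof (induction rule: borel_measurable_induct)
  case (cong f g) then show ?case by simp
next
  case (set A)
  then show ?case using D \<nu> eq[of A] by simp
next
  case (mult u c)
  note u = mult.hyps(2) and IH = mult.IH
  have "u \<in> borel_measurable D"
    using u by (simp add: measurable_cong_sets[OF D refl])
  moreover have "u \<in> borel_measurable (\<nu> j)" if "j < t" for j
    using u by (simp add: measurable_cong_sets[OF \<nu>[OF that] refl])
  ultimately show ?case using IH
    by (simp add: nn_integral_cmult sum_distrib_left mult_ac cong: sum.cong_simp)
next
  case (add u v)
  note uv = add.hyps(1,3) and IH = add.IH
  have "u \<in> borel_measurable D" "v \<in> borel_measurable D"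
    using uv by (simp_all add: measurable_cong_sets[OF D refl])
  moreover have "u \<in> borel_measurable (\<nu> j)" "v \<in> borel_measurable (\<nu> j)" if "j < t" for j
    using uv by (simp_all add: measurable_cong_sets[OF \<nu>[OF that] refl])
  ultimately show ?case using IH
    by (simp add: nn_integral_add sum.distrib distrib_left cong: sum.cong_simp)
next
  case (seq U)
  have "U i \<in> borel_measurable D" for i
    using seq.hyps(1) by (simp add: measurable_cong_sets[OF D refl])
  moreover have Uj: "U i \<in> borel_measurable (\<nu> j)" if "j < t" for i j
    using seq.hyps(1) by (simp add: measurable_cong_sets[OF \<nu>[OF that] refl])
  moreover have inc: "incseq U" using seq.hyps by simp
  ultimately have "(\<integral>\<^sup>+x. (SUP i. U i x) \<partial>D) = (SUP i. \<Sum>j<t. p j * (\<integral>\<^sup>+x. U i x \<partial>\<nu> j))"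
    by (simp add: nn_integral_monotone_convergence_SUP seq.IH)
  also have "\<dots> = (\<Sum>j<t. SUP i. p j * (\<integral>\<^sup>+x. U i x \<partial>\<nu> j))"
    using inc by (intro ennreal_SUP_sum) (auto simp: incseq_def le_fun_def intro!: mult_left_mono nn_integral_mono)
  also have "\<dots> = (\<Sum>j<t. p j * (\<integral>\<^sup>+x. (SUP i. U i x) \<partial>\<nu> j))"
    using inc Uj by (intro sum.cong refl) (simp add: nn_integral_monotone_convergence_SUP SUP_mult_left_ennreal)
  finally show ?case by (simp add: seq.hyps image_image SUP_apply cong: nn_integral_cong)
qed

text \<open>A single predicate, so that coordinates can be chosen for all components at once.
  \<open>T\<close> maps standard coordinates to instances, \<open>A\<close> transports normal
  vectors, and \<open>I\<close> encodes the target's labels as a condition on the coordinate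
  \<open>i\<^sub>0\<close>.\<close>

definition separating_frame ::
    "real \<times> (real ^ 'k) \<Rightarrow> 'k \<Rightarrow> (real ^ 'k) measure \<Rightarrow> (real ^ 'k \<Rightarrow> real ^ 'k) \<Rightarrow>
      (real ^ 'k \<Rightarrow> real ^ 'k) \<Rightarrow> (real ^ 'k \<Rightarrow> real ^ 'k) \<Rightarrow> real set \<Rightarrow> bool" where
  "separating_frame \<theta>\<^sub>0 i\<^sub>0 \<nu> T T' A I \<longleftrightarrow>
    I \<in> sets borel \<and> T \<in> borel_measurable borel \<and> T' \<in> borel_measurable borel \<and>
    (\<forall>x. T (T' x) = x) \<and> (\<forall>z. T' (T z) = z) \<and> \<nu> = distr std_gauss borel T \<and>
    (\<forall>v z z'. (T z - T z') \<bullet> v = (z - z') \<bullet> A v) \<and>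
    (\<forall>s z. emeasure \<nu> {x. (\<forall>i. 0 \<le> s i * (T' x $ i - z $ i)) \<and> sep \<theta>\<^sub>0 x = sep \<theta>\<^sub>0 (T z)}
      = ennreal (\<Prod>i\<in>UNIV. orthant_mass (axis_set i\<^sub>0 I i) (s i) (z $ i)))"

text \<open>In the coordinates of \<open>diagonal_normal_frame\<close> the target's affine function
  is \<open>c + \<kappa> * z $ i\<^sub>0\<close>, so its label depends on one coordinate and
  \<open>emeasure_orthant\<close> applies.\<close>

lemma separating_frame_exists:
  assumes "\<nu> \<in> diagonal_normals"
  shows "\<exists>T T' A I. separating_frame \<theta>\<^sub>0 i\<^sub>0 \<nu> T T' A I"
proof -
  obtain T T' A \<kappa> where T[measurable]: "T \<in> borel_measurable borel" "T' \<in> borel_measurable borel"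
    and TT': "\<And>x. T (T' x) = x" "\<And>z. T' (T z) = z" and \<nu>: "\<nu> = distr std_gauss borel T"
    and A: "\<And>v z z'. (T z - T z') \<bullet> v = (z - z') \<bullet> A v" and Aw: "A (snd \<theta>\<^sub>0) = \<kappa> *\<^sub>R axis i\<^sub>0 1"
    by (rule diagonal_normal_frame[OF assms, of "snd \<theta>\<^sub>0" i\<^sub>0]) auto
  define c where "c = aff \<theta>\<^sub>0 (T 0)"
  define I where "I = {u. 0 \<le> c + \<kappa> * u}"
  have I: "I \<in> sets borel"
  proof -
    have "{u \<in> space borel. 0 \<le> c + \<kappa> * u} \<in> sets borel" by measurable
    then show ?thesis by (simp add: I_def)
  qed
  have "aff \<theta>\<^sub>0 (T z) = c + \<kappa> * z $ i\<^sub>0" for z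
  proof -
    have "aff \<theta>\<^sub>0 (T z) = c + (T z - T 0) \<bullet> snd \<theta>\<^sub>0" by (simp add: aff_def c_def inner_diff_left)
    then show ?thesis by (simp add: A Aw inner_axis)
  qed
  then have sepT: "sep \<theta>\<^sub>0 (T y) = sep \<theta>\<^sub>0 (T z) \<longleftrightarrow> (y $ i\<^sub>0 \<in> I \<longleftrightarrow> z $ i\<^sub>0 \<in> I)" for y z
    by (auto simp: sep_def sign_label_def I_def)
  have "emeasure \<nu> {x. (\<forall>i. 0 \<le> s i * (T' x $ i - z $ i)) \<and> sep \<theta>\<^sub>0 x = sep \<theta>\<^sub>0 (T z)}
      = ennreal (\<Prod>i\<in>UNIV. orthant_mass (axis_set i\<^sub>0 I i) (s i) (z $ i))" for s z
  proof -
    have [measurable]: "(\<lambda>x. T' x $ i) \<in> borel_measurable borel" for i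
      by (rule measurable_compose[OF T(2) borel_measurable_vec_nth])
    have "{x \<in> space borel. (\<forall>i. 0 \<le> s i * (T' x $ i - z $ i)) \<and> sep \<theta>\<^sub>0 x = sep \<theta>\<^sub>0 (T z)} \<in> sets borel"
      by measurable
    then have "emeasure \<nu> {x. (\<forall>i. 0 \<le> s i * (T' x $ i - z $ i)) \<and> sep \<theta>\<^sub>0 x = sep \<theta>\<^sub>0 (T z)}
        = emeasure std_gauss {y. (\<forall>i. 0 \<le> s i * (y $ i - z $ i)) \<and> (y $ i\<^sub>0 \<in> I \<longleftrightarrow> z $ i\<^sub>0 \<in> I)}"
      unfolding \<nu> by (subst emeasure_distr) (auto simp: TT' sepT vimage_def)
    then show ?thesis by (simp only: emeasure_orthant[OF I])
  qed
  with I T TT' \<nu> A have "separating_frame \<theta>\<^sub>0 i\<^sub>0 \<nu> T T' A I"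
    unfolding separating_frame_def by (intro conjI allI)
  then show ?thesis by blast
qed

context realizable_separator
begin

lemma sample_labels_AE: "AE S in \<Omega>. \<forall>j. snd (S j) = sep \<theta>\<^sub>0 (fst (S j))"
  unfolding AE_all_countable
  by (intro allI AE_PiM_component labels) (auto intro: prob_space_axioms)

lemma DIS_event:
  assumes "finite J"
  shows "{q \<in> space (\<Omega> \<Otimes>\<^sub>M borel). snd q \<in> DIS (VS F (fst q ` J))} \<in> sets (\<Omega> \<Otimes>\<^sub>M borel)"
proof -
  let ?N = "PiM J (\<lambda>_. P) \<Otimes>\<^sub>M P"
  let ?Q = "{p \<in> space ?N. snd p \<in> {z. fst z \<in> DIS (VS F (fst p ` J))}}"
  \<comment> \<open>The label 1 is a dummy that turns the instance into an example; the region
    ignores it.\<close>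
  let ?g = "\<lambda>q. (restrict (fst q) J, (snd q, 1 :: int))"
  have "1 \<in> space label_space" by (simp add: label_space_def)
  then have "(\<lambda>q. (snd q, 1)) \<in> \<Omega> \<Otimes>\<^sub>M borel \<rightarrow>\<^sub>M borel \<Otimes>\<^sub>M label_space" by measurable
  then have "(\<lambda>q. (snd q, 1)) \<in> \<Omega> \<Otimes>\<^sub>M borel \<rightarrow>\<^sub>M P"
    by (simp only: measurable_cong_sets[OF refl sets_P])
  then have g: "?g \<in> \<Omega> \<Otimes>\<^sub>M borel \<rightarrow>\<^sub>M ?N"
    by (intro measurable_Pair measurable_compose[OF measurable_fst measurable_restrict_subset]) auto
  have "?g -` ?Q \<inter> space (\<Omega> \<Otimes>\<^sub>M borel) \<in> sets (\<Omega> \<Otimes>\<^sub>M borel)"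
    by (rule measurable_sets[OF g region_measurable[OF assms]])
  also have "?g -` ?Q \<inter> space (\<Omega> \<Otimes>\<^sub>M borel) = {q \<in> space (\<Omega> \<Otimes>\<^sub>M borel). snd q \<in> DIS (VS F (fst q ` J))}"
    using measurable_space[OF g] by auto
  finally show ?thesis .
qed

text \<open>By \<open>DIS_empty_orthant\<close>, almost surely some orthant at \<open>x\<close>,
  restricted to the label of \<open>x\<close>, has been missed by all examples at \<open>J\<close>.
  For each sign pattern, independence makes the probability of this a power with exponent
  \<open>card J\<close>.\<close>

lemma emeasure_DIS_le:
  fixes T T' :: "real ^ 'k \<Rightarrow> real ^ 'k"
  assumes J: "finite J"
    and T: "\<And>v z z'. (T z - T z') \<bullet> v = (z - z') \<bullet> A v" "\<And>x. T (T' x) = x"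
    and T': "T' \<in> borel_measurable borel"
  shows "emeasure \<Omega> {S \<in> space \<Omega>. x \<in> DIS (VS F (S ` J))} \<le> (\<Sum>s\<in>signs. ennreal ((1 -
      prob {z \<in> space P. (\<forall>i. 0 \<le> s i * (T' (fst z) $ i - T' x $ i)) \<and> sep \<theta>\<^sub>0 (fst z) = sep \<theta>\<^sub>0 x}) ^ card J))"
proof -
  let ?B = "\<lambda>s. {z \<in> space P. (\<forall>i. 0 \<le> s i * (T' (fst z) $ i - T' x $ i)) \<and> sep \<theta>\<^sub>0 (fst z) = sep \<theta>\<^sub>0 x}"
  let ?A = "\<lambda>s. {S \<in> space \<Omega>. \<forall>j\<in>J. S j \<in> space P - ?B s}"
  have B[measurable]: "?B s \<in> sets P" for s
  proof -
    have [measurable]: "(\<lambda>x. T' x $ i) \<in> borel_measurable borel" for i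
      by (rule measurable_compose[OF T' borel_measurable_vec_nth])
    show ?thesis by measurable
  qed
  have As: "?A s \<in> sets \<Omega>" for s
    using J by measurable
  have "emeasure \<Omega> {S \<in> space \<Omega>. x \<in> DIS (VS F (S ` J))} \<le> emeasure \<Omega> (\<Union>s\<in>signs. ?A s)"
  proof (rule emeasure_mono_AE)
    show "AE S in \<Omega>. S \<in> {S \<in> space \<Omega>. x \<in> DIS (VS F (S ` J))} \<longrightarrow> S \<in> (\<Union>s\<in>signs. ?A s)"
      using sample_labels_AE AE_space
    proof eventually_elim
      fix S assume S: "\<forall>j. snd (S j) = sep \<theta>\<^sub>0 (fst (S j))" "S \<in> space \<Omega>"
      show "S \<in> {S \<in> space \<Omega>. x \<in> DIS (VS F (S ` J))} \<longrightarrow> S \<in> (\<Union>s\<in>signs. ?A s)"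
      proof
        assume "S \<in> {S \<in> space \<Omega>. x \<in> DIS (VS F (S ` J))}"
        then have dis: "x \<in> DIS (VS F (S ` J))" by simp
        obtain s where s: "s \<in> signs" "\<And>z. z \<in> S ` J \<Longrightarrow>
            \<not> ((\<forall>i. 0 \<le> s i * (T' (fst z) $ i - T' x $ i)) \<and> sep \<theta>\<^sub>0 (fst z) = sep \<theta>\<^sub>0 x)"
          by (rule DIS_empty_orthant[OF T dis, of \<theta>\<^sub>0]) (use S(1) in auto)
        have "S j \<in> space P" for j using S(2) by (auto simp: space_PiM)
        then have "S \<in> ?A s" using S(2) s(2) by simp
        then show "S \<in> (\<Union>s\<in>signs. ?A s)" using s(1) by blast
      qed
    qed
    show "(\<Union>s\<in>signs. ?A s) \<in> sets \<Omega>" using As by (intro sets.finite_UN finite_signs) auto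
  qed
  also have "\<dots> \<le> (\<Sum>s\<in>signs. emeasure \<Omega> (?A s))"
    using As by (intro emeasure_subadditive_finite finite_signs) auto
  also have "\<dots> = (\<Sum>s\<in>signs. ennreal ((1 - prob (?B s)) ^ card J))"
  proof (rule sum.cong[OF refl])
    fix s
    have "emeasure \<Omega> (?A s) = (\<Prod>j\<in>J. emeasure P (space P - ?B s))"
      using J by (intro seq.emeasure_PiM_Collect) auto
    also have "emeasure P (space P - ?B s) = ennreal (1 - prob (?B s))"
      unfolding emeasure_eq_measure by (simp only: prob_compl[OF B])
    also have "(\<Prod>j\<in>J. ennreal (1 - prob (?B s))) = ennreal ((1 - prob (?B s)) ^ card J)"
      by (simp add: ennreal_power)
    finally show "emeasure \<Omega> (?A s) = ennreal ((1 - prob (?B s)) ^ card J)" .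
  qed
  finally show ?thesis .
qed

text \<open>By Fubini's theorem the mean mass is the mean over the instance of the probability in
  \<open>emeasure_DIS_le\<close>. The function \<open>p\<close> is an upper bound for it rather than
  the mean itself, since a bound in closed form depends on the sample size only and is visibly
  antitone. In dimension k the constant is the product of t components, 2^k sign patterns and the
  factor 2 * 2^k * 8^k from \<open>nn_integral_orthant_sum_le\<close>.\<close>

lemma expected_mass:
  assumes "mixture_of t diagonal_normals (distr P borel fst)"
  obtains p :: "nat \<Rightarrow> real" where "\<And>m. 0 \<le> p m" "\<And>m n. m \<le> n \<Longrightarrow> p n \<le> p m"
    "\<And>J. finite J \<Longrightarrow> (\<integral>\<^sup>+S. mass J S \<partial>\<Omega>) \<le> ennreal (p (card J))"
    "\<And>N. 1 \<le> N \<Longrightarrow> (\<Sum>m<2 ^ N. p m) \<le> 2 * t * 32 ^ CARD('k) * N ^ CARD('k)"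
proof -
  let ?D = "distr P borel fst"
  obtain a \<nu> where a: "\<And>j. j < t \<Longrightarrow> 0 \<le> a j" "(\<Sum>j<t. a j) = 1" and \<nu>: "\<And>j. j < t \<Longrightarrow> \<nu> j \<in> diagonal_normals"
    and mix: "\<And>X. X \<in> sets borel \<Longrightarrow> emeasure ?D X = (\<Sum>j<t. ennreal (a j) * emeasure (\<nu> j) X)"
    using assms unfolding mixture_of_def by blast
  have a1: "a j \<le> 1" if "j < t" for j
    using member_le_sum[of j "{..<t}" a] a that by auto
  obtain i\<^sub>0 :: 'k where True by simp
  have "\<forall>j\<in>{..<t}. \<exists>T T' A I. separating_frame \<theta>\<^sub>0 i\<^sub>0 (\<nu> j) T T' A I"
    using separating_frame_exists \<nu> by blast
  then obtain T T' A I where frame: "\<And>j. j < t \<Longrightarrow> separating_frame \<theta>\<^sub>0 i\<^sub>0 (\<nu> j) (T j) (T' j) (A j) (I j)"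
    unfolding bchoice_iff by blast
  have I: "I j \<in> sets borel" if "j < t" for j
    using frame[OF that] by (simp add: separating_frame_def)
  define \<omega> where "\<omega> j s z = (\<Prod>i\<in>UNIV. orthant_mass (axis_set i\<^sub>0 (I j) i) (s i) (z $ i))" for j s and z :: "real ^ 'k"
  have o01: "0 \<le> \<omega> j s z" "\<omega> j s z \<le> 1" for j s z
    by (auto simp: \<omega>_def orthant_mass_nonneg orthant_mass_le_1 intro!: prod_nonneg prod_le_1)
  have ao: "0 \<le> a j * \<omega> j s z" "a j * \<omega> j s z \<le> 1" if "j < t" for j s z
    using a(1)[OF that] a1[OF that] o01[of j s z] by (auto intro: mult_le_one)
  have om: "\<omega> j s \<in> borel_measurable borel" if "j < t" for j s
  proof -
    have "axis_set i\<^sub>0 (I j) i \<in> sets borel" for i using I[OF that] by simp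
    then show ?thesis unfolding \<omega>_def[abs_def]
      by (intro borel_measurable_prod measurable_compose[OF borel_measurable_vec_nth] orthant_mass_measurable)
  qed
  define u where "u m j s z = ennreal (a j * (1 - a j * \<omega> j s z) ^ m)" for m j s and z :: "real ^ 'k"
  have um: "u m j s \<in> borel_measurable std_gauss" if "j < t" for m j s
    using om[OF that] unfolding u_def[abs_def] by measurable
  define P' where "P' m = (\<Sum>j<t. \<Sum>s\<in>signs. \<integral>\<^sup>+z. u m j s z \<partial>std_gauss)" for m
  have P'_sum: "(\<Sum>m<2 ^ N. P' m) \<le> ennreal (2 * t * 32 ^ CARD('k) * N ^ CARD('k))" if N: "1 \<le> N" for N
  proof -
    have "(\<Sum>m<2 ^ N. P' m) = (\<Sum>j<t. \<Sum>m<2 ^ N. \<Sum>s\<in>signs. \<integral>\<^sup>+z. u m j s z \<partial>std_gauss)"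
      unfolding P'_def by (rule sum.swap)
    also have "\<dots> = (\<Sum>j<t. \<Sum>s\<in>signs. \<Sum>m<2 ^ N. \<integral>\<^sup>+z. u m j s z \<partial>std_gauss)"
      by (intro sum.cong refl sum.swap)
    also have "\<dots> \<le> (\<Sum>j<t. \<Sum>s\<in>(signs :: ('k \<Rightarrow> real) set). ennreal (2 * 2 ^ CARD('k) * (8 * real N) ^ CARD('k)))"
    proof (intro sum_mono)
      fix j and s :: "'k \<Rightarrow> real" assume "j \<in> {..<t}"
      then have j: "j < t" by simp
      have "(\<Sum>m<2 ^ N. \<integral>\<^sup>+z. u m j s z \<partial>std_gauss) = (\<integral>\<^sup>+z. (\<Sum>m<2 ^ N. u m j s z) \<partial>std_gauss)"
        by (rule nn_integral_sum[symmetric]) (rule um[OF j])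
      also have "\<dots> = (\<integral>\<^sup>+z. ennreal (\<Sum>m<2 ^ N. a j * (1 - a j * \<omega> j s z) ^ m) \<partial>std_gauss)"
        unfolding u_def using a(1)[OF j] ao[OF j] by (intro nn_integral_cong sum_ennreal) simp
      also have "\<dots> \<le> ennreal (2 * 2 ^ CARD('k) * (8 * real N) ^ CARD('k))"
        unfolding \<omega>_def using j by (intro nn_integral_orthant_sum_le I a(1) a1 N)
      finally show "(\<Sum>m<2 ^ N. \<integral>\<^sup>+z. u m j s z \<partial>std_gauss) \<le> ennreal (2 * 2 ^ CARD('k) * (8 * real N) ^ CARD('k))" .
    qed
    also have "\<dots> = ennreal (\<Sum>j<t. \<Sum>s\<in>(signs :: ('k \<Rightarrow> real) set). 2 * 2 ^ CARD('k) * (8 * real N) ^ CARD('k))"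
      by (subst sum_ennreal[symmetric] | simp add: sum_nonneg)+
    also have "(\<Sum>j<t. \<Sum>s\<in>(signs :: ('k \<Rightarrow> real) set). 2 * 2 ^ CARD('k) * (8 * real N) ^ CARD('k))
        = 2 * t * ((2 * 2 * 8) ^ CARD('k)) * N ^ CARD('k)"
      by (simp only: sum_constant card_signs power_mult_distrib card_lessThan of_nat_power) (simp add: mult_ac)
    finally show ?thesis by simp
  qed
  have fin: "P' m < \<infinity>" for m
  proof -
    have "P' m \<le> (\<Sum>m<2 ^ Suc m. P' m)"
      by (rule member_le_sum) (auto intro: less_le_trans[OF less_exp[of m]])
    also have "\<dots> < \<infinity>" by (rule le_less_trans[OF P'_sum]) auto
    finally show ?thesis .
  qed
  define p where "p m = enn2real (P' m)" for m
  have p: "ennreal (p m) = P' m" for m using fin by (simp add: p_def less_top)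
  show thesis
  proof (rule that)
    show "0 \<le> p m" for m by (simp add: p_def)
    show "p n \<le> p m" if "m \<le> n" for m n
    proof -
      have "P' n \<le> P' m" unfolding P'_def u_def
        using that a(1) ao by (intro sum_mono nn_integral_mono ennreal_leI mult_left_mono power_decreasing) auto
      then show ?thesis unfolding p_def using fin by (intro enn2real_mono) (auto simp: less_top)
    qed
    show "(\<Sum>m<2 ^ N. p m) \<le> 2 * t * 32 ^ CARD('k) * N ^ CARD('k)" if N: "1 \<le> N" for N
    proof -
      have "ennreal (\<Sum>m<2 ^ N. p m) = (\<Sum>m<2 ^ N. P' m)"
        by (subst sum_ennreal[symmetric]) (auto simp: p p_def[symmetric], simp add: p_def)
      also have "\<dots> \<le> ennreal (2 * t * 32 ^ CARD('k) * N ^ CARD('k))" by (rule P'_sum[OF N])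
      finally show ?thesis by (subst (asm) ennreal_le_iff) auto
    qed
    fix J :: "nat set" assume J: "finite J"
    interpret D: prob_space ?D by (rule prob_space_distr) measurable
    interpret OD: pair_prob_space \<Omega> ?D ..
    let ?Q = "{q \<in> space (\<Omega> \<Otimes>\<^sub>M borel). snd q \<in> DIS (VS F (fst q ` J))}"
    have Q: "?Q \<in> sets (\<Omega> \<Otimes>\<^sub>M borel)" by (rule DIS_event[OF J])
    then have Q': "?Q \<in> sets (\<Omega> \<Otimes>\<^sub>M ?D)" by (simp cong: sets_pair_measure_cong)
    define \<Phi> where "\<Phi> x = emeasure \<Omega> {S \<in> space \<Omega>. x \<in> DIS (VS F (S ` J))}" for x
    have sec: "(\<lambda>S. (S, x)) -` ?Q = {S \<in> space \<Omega>. x \<in> DIS (VS F (S ` J))}" for x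
      by (auto simp: space_pair_measure)
    have \<Phi>m: "\<Phi> \<in> borel_measurable borel"
      using OD.measurable_emeasure_Pair2[OF Q'] unfolding sec \<Phi>_def[abs_def] by simp
    have "(\<integral>\<^sup>+S. mass J S \<partial>\<Omega>) = (\<integral>\<^sup>+S. emeasure ?D (Pair S -` ?Q) \<partial>\<Omega>)"
    proof (rule nn_integral_cong)
      fix S assume S: "S \<in> space \<Omega>"
      have "Pair S -` ?Q \<in> sets borel" by (rule sets_Pair1[OF Q])
      then have "emeasure ?D (Pair S -` ?Q) = emeasure P (fst -` (Pair S -` ?Q) \<inter> space P)"
        by (subst emeasure_distr) auto
      also have "fst -` (Pair S -` ?Q) \<inter> space P = {z \<in> space P. z \<in> {z. fst z \<in> DIS (VS F (S ` J))}}"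
        using S by (auto simp: space_pair_measure)
      finally show "ennreal (mass J S) = emeasure ?D (Pair S -` ?Q)"
        by (simp add: mass_def emeasure_eq_measure)
    qed
    also have "\<dots> = emeasure (\<Omega> \<Otimes>\<^sub>M ?D) ?Q"
      by (rule D.emeasure_pair_measure_alt[OF Q', symmetric])
    also have "\<dots> = (\<integral>\<^sup>+x. \<Phi> x \<partial>?D)"
      unfolding \<Phi>_def sec[symmetric] by (rule OD.emeasure_pair_measure_alt2[OF Q'])
    also have "\<dots> = (\<Sum>j<t. ennreal (a j) * (\<integral>\<^sup>+x. \<Phi> x \<partial>\<nu> j))"
      using frame by (intro nn_integral_mixture mix \<Phi>m) (auto simp: separating_frame_def)
    also have "\<dots> \<le> P' (card J)"
      unfolding P'_def
    proof (rule sum_mono)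
      fix j assume "j \<in> {..<t}"
      then have j: "j < t" by simp
      from frame[OF j] have Tm[measurable]: "T j \<in> borel_measurable borel" "T' j \<in> borel_measurable borel"
        and TT: "\<And>x. T j (T' j x) = x" "\<And>z. T' j (T j z) = z" and \<nu>j: "\<nu> j = distr std_gauss borel (T j)"
        and TA: "\<And>v z z'. (T j z - T j z') \<bullet> v = (z - z') \<bullet> A j v"
        and oj: "\<And>s z. emeasure (\<nu> j) {x. (\<forall>i. 0 \<le> s i * (T' j x $ i - z $ i)) \<and> sep \<theta>\<^sub>0 x = sep \<theta>\<^sub>0 (T j z)}
          = ennreal (\<omega> j s z)"
        unfolding separating_frame_def \<omega>_def by blast+
      have "\<Phi> (T j z) \<le> (\<Sum>s\<in>signs. ennreal ((1 - a j * \<omega> j s z) ^ card J))" for z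
      proof -
        let ?B = "\<lambda>s. {w \<in> space P. (\<forall>i. 0 \<le> s i * (T' j (fst w) $ i - T' j (T j z) $ i)) \<and> sep \<theta>\<^sub>0 (fst w) = sep \<theta>\<^sub>0 (T j z)}"
        \<comment> \<open>Of the mass of the orthant only the share of component \<open>j\<close> is
          kept; the other shares need not factor in these coordinates.\<close>
        have lower: "a j * \<omega> j s z \<le> prob (?B s)" for s
        proof -
          let ?X = "{x. (\<forall>i. 0 \<le> s i * (T' j x $ i - z $ i)) \<and> sep \<theta>\<^sub>0 x = sep \<theta>\<^sub>0 (T j z)}"
          have [measurable]: "(\<lambda>x. T' j x $ i) \<in> borel_measurable borel" for i
            by (rule measurable_compose[OF Tm(2) borel_measurable_vec_nth])
          have "{x \<in> space borel. (\<forall>i. 0 \<le> s i * (T' j x $ i - z $ i)) \<and> sep \<theta>\<^sub>0 x = sep \<theta>\<^sub>0 (T j z)} \<in> sets borel"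
            by measurable
          then have X: "?X \<in> sets borel" by simp
          have "ennreal (a j * \<omega> j s z) = ennreal (a j) * emeasure (\<nu> j) ?X"
            using a(1)[OF j] o01 by (simp add: oj ennreal_mult)
          also have "\<dots> \<le> (\<Sum>j<t. ennreal (a j) * emeasure (\<nu> j) ?X)"
            using j by (intro member_le_sum) auto
          also have "\<dots> = emeasure ?D ?X" by (rule mix[OF X, symmetric])
          also have "\<dots> = emeasure P (fst -` ?X \<inter> space P)" using X by (subst emeasure_distr) auto
          also have "fst -` ?X \<inter> space P = ?B s" by (auto simp: TT)
          finally show ?thesis by (simp add: emeasure_eq_measure)
        qed
        have "\<Phi> (T j z) \<le> (\<Sum>s\<in>signs. ennreal ((1 - prob (?B s)) ^ card J))"
          unfolding \<Phi>_def by (rule emeasure_DIS_le[OF J TA TT(1) Tm(2)])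
        also have "\<dots> \<le> (\<Sum>s\<in>signs. ennreal ((1 - a j * \<omega> j s z) ^ card J))"
          using lower by (intro sum_mono ennreal_leI power_mono) auto
        finally show ?thesis .
      qed
      then have "(\<integral>\<^sup>+x. \<Phi> x \<partial>\<nu> j) \<le> (\<integral>\<^sup>+z. (\<Sum>s\<in>signs. ennreal ((1 - a j * \<omega> j s z) ^ card J)) \<partial>std_gauss)"
        unfolding \<nu>j by (subst nn_integral_distr) (auto intro!: nn_integral_mono \<Phi>m)
      also have "ennreal (a j) * \<dots> = (\<integral>\<^sup>+z. ennreal (a j) * (\<Sum>s\<in>signs. ennreal ((1 - a j * \<omega> j s z) ^ card J)) \<partial>std_gauss)"
        using om[OF j] by (intro nn_integral_cmult[symmetric]) measurable
      also have "\<dots> = (\<integral>\<^sup>+z. (\<Sum>s\<in>signs. u (card J) j s z) \<partial>std_gauss)"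
        unfolding u_def sum_distrib_left using a(1)[OF j] ao[OF j]
        by (intro nn_integral_cong sum.cong refl ennreal_mult[symmetric]) auto
      also have "\<dots> = (\<Sum>s\<in>signs. \<integral>\<^sup>+z. u (card J) j s z \<partial>std_gauss)"
        by (rule nn_integral_sum) (rule um[OF j])
      finally show "ennreal (a j) * (\<integral>\<^sup>+x. \<Phi> x \<partial>\<nu> j) \<le> (\<Sum>s\<in>signs. \<integral>\<^sup>+z. u (card J) j s z \<partial>std_gauss)"
        by (simp add: mult_left_mono)
    qed
    finally show "(\<integral>\<^sup>+S. mass J S \<partial>\<Omega>) \<le> ennreal (p (card J))" by (simp only: p)
  qed
qed

end

section \<open>The label complexity bound\<close>

text \<open>Cauchy condensation: by antitonicity \<open>2 ^ N * p (2 ^ Suc N)\<close> is at most the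
  sum over the stretch from \<open>2 ^ N\<close> to \<open>2 ^ Suc N\<close>. Doubling gives two
  copies of the sum, and the third pays for the term with \<open>i = 0\<close>.\<close>

lemma dyadic_sum_le:
  fixes p :: "nat \<Rightarrow> real"
  assumes p: "\<And>m. 0 \<le> p m" and anti: "\<And>m n. m \<le> n \<Longrightarrow> p n \<le> p m"
  shows "(\<Sum>i<N. 2 ^ i * p (2 ^ i)) \<le> 3 * (\<Sum>m<2 ^ N. p m)"
proof -
  have "(\<Sum>i\<le>N. 2 ^ i * p (2 ^ i)) \<le> p 1 + 2 * (\<Sum>m<2 ^ N. p m)"
  proof (induction N)
    case 0 then show ?case using p[of 0] by simp
  next
    case (Suc N)
    have "2 ^ N * p (2 ^ Suc N) = (\<Sum>m\<in>{(2::nat) ^ N..<2 ^ Suc N}. p (2 ^ Suc N))" by simp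
    also have "\<dots> \<le> (\<Sum>m\<in>{(2::nat) ^ N..<2 ^ Suc N}. p m)" by (intro sum_mono anti) auto
    also have "\<dots> = (\<Sum>m<2 ^ Suc N. p m) - (\<Sum>m<2 ^ N. p m)"
      using sum.atLeastLessThan_concat[of 0 "2 ^ N" "2 ^ Suc N" p] by (simp add: lessThan_atLeast0)
    finally show ?case using Suc by simp
  qed
  moreover have "(\<Sum>i<N. 2 ^ i * p (2 ^ i)) \<le> (\<Sum>i\<le>N. 2 ^ i * p (2 ^ i))"
    using p by (intro sum_mono2) auto
  moreover have "p 1 \<le> (\<Sum>m<2 ^ N. p m)"
    using anti[of 0 1] member_le_sum[of 0 "{..<2 ^ N}" p] p by force
  ultimately show ?thesis by simp
qed

context realizable_separator
begin

text \<open>The target is itself in the version space, so a member that errs at an instance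
  disagrees there with the target.\<close>

lemma er_le_mass:
  assumes J: "finite J" and S: "S \<in> space \<Omega>" "\<And>j. snd (S j) = sep \<theta>\<^sub>0 (fst (S j))"
    and h: "h \<in> VS F (S ` J)"
  shows "er P h \<le> mass J S"
  unfolding er_def mass_def
proof (rule finite_measure_mono_AE)
  show "{z \<in> space P. z \<in> {z. fst z \<in> DIS (VS F (S ` J))}} \<in> sets P"
    by (rule region_slice_UNIV[OF J S(1)])
  have "sep \<theta>\<^sub>0 \<in> VS F (S ` J)" using S(2) by (auto simp: mem_VS_iff)
  then have "x \<in> DIS (VS F (S ` J))" if "h x \<noteq> sep \<theta>\<^sub>0 x" for x
    using h that unfolding DIS_def by blast
  with labels show "AE z in P. z \<in> {z \<in> space P. h (fst z) \<noteq> snd z} \<longrightarrow>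
      z \<in> {z \<in> space P. z \<in> {z. fst z \<in> DIS (VS F (S ` J))}}"
    by (auto elim!: eventually_mono)
qed

text \<open>The condition on \<epsilon> forces \<open>2 * p (2 ^ N) \<le> \<epsilon>\<close>,
  because \<open>2 ^ N * p (2 ^ N)\<close> is at most the sum of the first \<open>2 ^ N\<close>
  values of \<open>p\<close>. In the condition on \<open>n\<close>, 12 is 4 from
  \<open>boosting\<close> times 3 from \<open>dyadic_sum_le\<close>.\<close>

lemma label_complexity_le:
  assumes mix: "mixture_of t diagonal_normals (distr P borel fst)"
    and "1 \<le> N" "0 < q"
    and \<epsilon>: "2 * (2 * t * 32 ^ CARD('k)) * real N ^ CARD('k) \<le> \<epsilon> * 2 ^ N"
    and \<delta>: "(2 * real N + 1) * (1 / 2) ^ q \<le> \<delta>"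
    and n: "q * (1 + 12 * (2 * t * 32 ^ CARD('k)) * real N ^ CARD('k) + N) < n"
  shows "label_complexity F P \<epsilon> \<delta> \<le> enat n"
proof -
  obtain p :: "nat \<Rightarrow> real" where p: "\<And>m. 0 \<le> p m" and anti: "\<And>m n. m \<le> n \<Longrightarrow> p n \<le> p m"
    and mean: "\<And>J. finite J \<Longrightarrow> (\<integral>\<^sup>+S. mass J S \<partial>\<Omega>) \<le> ennreal (p (card J))"
    and sum': "\<And>N. 1 \<le> N \<Longrightarrow> (\<Sum>m<2 ^ N. p m) \<le> 2 * t * 32 ^ CARD('k) * N ^ CARD('k)"
    by (rule expected_mass[OF mix], rule that)
  let ?C = "2 * t * 32 ^ CARD('k) * real N ^ CARD('k)"
  have sum: "(\<Sum>m<2 ^ N. p m) \<le> ?C" using sum'[OF \<open>1 \<le> N\<close>] by simp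
  let ?m = "q * 2 ^ N"
  have "2 ^ N * p (2 ^ N) = (\<Sum>m<(2::nat) ^ N. p (2 ^ N))" by simp
  also have "\<dots> \<le> (\<Sum>m<2 ^ N. p m)" by (intro sum_mono anti) auto
  also note sum
  finally have "2 * (2 ^ N * p (2 ^ N)) \<le> 2 * ?C" by (rule mult_left_mono) simp
  also have "\<dots> \<le> \<epsilon> * 2 ^ N" using \<epsilon> by (simp add: mult.assoc)
  finally have "(2 * p (2 ^ N)) * 2 ^ N \<le> \<epsilon> * 2 ^ N" by (simp only: mult_ac)
  then have p\<epsilon>: "2 * p (2 ^ N) \<le> \<epsilon>" by (rule mult_right_le_imp_le) simp
  have "q + (\<Sum>i<N. 4 * q * 2 ^ i * p (2 ^ i) + q) = q * (1 + 4 * (\<Sum>i<N. 2 ^ i * p (2 ^ i)) + N)"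
    by (simp add: sum.distrib sum_distrib_left algebra_simps)
  also have "\<dots> \<le> q * (1 + 4 * (3 * ?C) + N)"
    using dyadic_sum_le[of p N, OF p anti] sum by (intro mult_left_mono add_mono) auto
  also have "\<dots> < n" using n by (simp add: mult_ac)
  finally have budget: "q + (\<Sum>i<N. 4 * q * 2 ^ i * p (2 ^ i) + q) < real n" .
  obtain B where B: "B \<in> sets \<Omega>" "measure \<Omega> B \<le> (2 * N + 1) * (1 / 2) ^ q"
    and massB: "\<And>S. S \<in> space \<Omega> - B \<Longrightarrow> mass {..<?m} S \<le> 2 * p (2 ^ N)"
    and hitsB: "\<And>S. S \<in> space \<Omega> - B \<Longrightarrow>
      real (\<Sum>j<?m. of_bool (S j \<in> {z. fst z \<in> DIS (VS F (S ` {..<j}))}))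
      \<le> q + (\<Sum>i<N. 4 * q * 2 ^ i * p (2 ^ i) + q)"
    by (rule boosting[OF \<open>0 < q\<close> p mean, of N]) auto
  let ?E = "{S \<in> space \<Omega>. (SUP h\<in>VS F (sample S (label_time F S n)). ereal (er P h)) \<le> ereal \<epsilon>}"
  have "1 - \<delta> \<le> 1 - measure \<Omega> B" using B(2) \<delta> by (simp add: add.commute)
  also have "\<dots> = measure \<Omega> (space \<Omega> - B)" by (rule seq.prob_compl[OF B(1), symmetric])
  also have "\<dots> \<le> measure \<Omega> ?E"
  proof (rule seq.finite_measure_mono_AE[OF _ success_event])
    show "AE S in \<Omega>. S \<in> space \<Omega> - B \<longrightarrow> S \<in> ?E"
      using sample_labels_AE
    proof eventually_elim
      fix S :: "nat \<Rightarrow> (real ^ 'k) \<times> int"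
      assume lab: "\<forall>j. snd (S j) = sep \<theta>\<^sub>0 (fst (S j))"
      show "S \<in> space \<Omega> - B \<longrightarrow> S \<in> ?E"
      proof
        assume S: "S \<in> space \<Omega> - B"
        have "num_labels F S ?m = (\<Sum>j<?m. of_bool (S j \<in> {z. fst z \<in> DIS (VS F (S ` {..<j}))}))"
          by (simp add: num_labels_def sample_enat)
        \<comment> \<open>So the \<open>n\<close>-th request comes after the first \<open>?m\<close>
          examples or never, and all of them belong to the sample that determines the version
          space.\<close>
        with hitsB[OF S] budget have lt: "num_labels F S ?m < n" by linarith
        have "S ` {..<?m} \<subseteq> sample S (label_time F S n)"
        proof (cases "label_time F S n")
          case (enat m)
          then have "num_labels F S m = n" by (simp add: label_time_eq_enat)
          then have "?m < m" using lt num_labels_mono[of m ?m F S] by (meson leD leI)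
          then show ?thesis by (auto simp: enat sample_enat)
        qed (auto simp: sample_infinity)
        from VS_antimono[OF this] have "er P h \<le> \<epsilon>" if "h \<in> VS F (sample S (label_time F S n))" for h
          using er_le_mass[of "{..<?m}" S h] lab S massB[OF S] p\<epsilon> that by force
        then show "S \<in> ?E" using S by (auto simp: SUP_le_iff)
      qed
    qed
  qed
  finally have "measure \<Omega> ?E \<ge> 1 - \<delta>" .
  moreover have "1 \<le> n"
  proof (rule ccontr)
    assume "\<not> 1 \<le> n"
    then have "real n = 0" by simp
    moreover have "0 \<le> q * (1 + 12 * (2 * real t * 32 ^ CARD('k)) * real N ^ CARD('k) + N)" by simp
    ultimately show False using n by linarith
  qed
  ultimately show ?thesis
    unfolding label_complexity_def by (intro Inf_lower) auto
qed

end

section \<open>Choice of the numerical parameters\<close>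

lemma exponential_beats_power:
  fixes C :: real
  shows "\<exists>n\<^sub>0. \<forall>n\<ge>n\<^sub>0. C * real n ^ k \<le> sqrt 2 ^ n"
proof -
  have "(\<lambda>n. real n ^ k / sqrt 2 ^ n) \<longlonglongrightarrow> 0"
    by real_asymp
  then have "(\<lambda>n. C * (real n ^ k / sqrt 2 ^ n)) \<longlonglongrightarrow> C * 0" by (intro tendsto_intros)
  then have "\<forall>\<^sub>F n in sequentially. C * (real n ^ k / sqrt 2 ^ n) < 1"
    by (rule order_tendstoD) simp
  then obtain n\<^sub>0 where "\<forall>n\<ge>n\<^sub>0. C * (real n ^ k / sqrt 2 ^ n) < 1" by (auto simp: eventually_sequentially)
  then show ?thesis by (intro exI[of _ n\<^sub>0]) (auto simp: field_simps intro: less_imp_le)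
qed

text \<open>As \<epsilon> and \<delta> are at most 1/2, \<open>x = ln (1 / \<epsilon>)\<close> and
  \<open>y = ln (x / \<delta>)\<close> are bounded away from 0. Additive constants can therefore be
  absorbed: \<open>N \<le> a * x\<close>, \<open>2 * N + 1 \<le> K * x\<close> and
  \<open>q \<le> b * y\<close>, which explains \<open>a\<close>, \<open>K\<close> and
  \<open>b\<close>.\<close>

lemma budget_bound:
  fixes C :: real and k :: nat
  assumes C: "0 \<le> C" and k: "1 \<le> k"
  obtains c :: real where "c > 0" "\<And>\<epsilon> \<delta> :: real. 0 < \<epsilon> \<Longrightarrow> \<epsilon> \<le> 1 / 2 \<Longrightarrow> 0 < \<delta> \<Longrightarrow> \<delta> \<le> 1 / 2 \<Longrightarrow>
    \<exists>N q n :: nat. 1 \<le> N \<and> 0 < q \<and> 2 * C * real N ^ k \<le> \<epsilon> * 2 ^ N \<and>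
      (2 * real N + 1) * (1 / 2) ^ q \<le> \<delta> \<and> q * (1 + 12 * C * real N ^ k + N) < n \<and>
      real n \<le> c * ln (1 / \<epsilon>) ^ k * ln (ln (1 / \<epsilon>) / \<delta>)"
proof -
  obtain n\<^sub>0 where n\<^sub>0: "\<And>n. n \<ge> n\<^sub>0 \<Longrightarrow> 2 * C * real n ^ k \<le> sqrt 2 ^ n"
    using exponential_beats_power[of "2 * C" k] by blast
  define y\<^sub>0 :: real where "y\<^sub>0 = ln (4 / 3)"
  have y\<^sub>0: "0 < y\<^sub>0" by (simp add: y\<^sub>0_def)
  have l2: "2 / 3 \<le> ln (2::real)" by (rule ln2_ge_two_thirds)
  define a where "a = 2 * real n\<^sub>0 + 5"
  define K where "K = 2 * a + 2"
  define b where "b = (2 * ln K + 1) / y\<^sub>0 + 2"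
  define c where "c = b * (2 * 2 ^ k + 12 * C * a ^ k + a * 2 ^ k)"
  have a: "5 \<le> a" and K: "12 \<le> K" by (auto simp: a_def K_def)
  have "0 < ln K" using K by simp
  then have b: "2 \<le> b" using y\<^sub>0 by (simp add: b_def)
  show thesis
  proof (rule that)
    have "0 < 2 * 2 ^ k + 12 * C * a ^ k + a * 2 ^ k"
      using C a by (intro add_pos_nonneg) auto
    then show "c > 0" using b by (simp add: c_def)
    fix \<epsilon> \<delta> :: real assume \<epsilon>: "0 < \<epsilon>" "\<epsilon> \<le> 1 / 2" and \<delta>: "0 < \<delta>" "\<delta> \<le> 1 / 2"
    define x where "x = ln (1 / \<epsilon>)"
    define y where "y = ln (x / \<delta>)"
    have "ln 2 \<le> x" unfolding x_def using \<epsilon> by (subst ln_le_cancel_iff) (auto simp: field_simps)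
    then have x: "2 / 3 \<le> x" using l2 by simp
    have "4 / 3 \<le> x / \<delta>" using x \<delta> by (simp add: field_simps)
    then have y: "y\<^sub>0 \<le> y" unfolding y_def y\<^sub>0_def using x \<delta> by (subst ln_le_cancel_iff) auto
    \<comment> \<open>In \<open>2 ^ N = sqrt 2 ^ N * sqrt 2 ^ N\<close> one factor has to reach
      \<open>1 / \<epsilon>\<close>, which the second summand ensures, and the other the multiple of
      \<open>N ^ k\<close>, which \<open>n\<^sub>0\<close> ensures.\<close>
    define N where "N = n\<^sub>0 + nat \<lceil>2 * x / ln 2\<rceil>"
    have ceil: "2 * x / ln 2 \<le> nat \<lceil>2 * x / ln 2\<rceil>" "real (nat \<lceil>2 * x / ln 2\<rceil>) \<le> 2 * x / ln 2 + 1"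
      using x l2 by (auto simp: of_nat_nat ceiling_correct)
    have "0 < 2 * x / ln 2" using x l2 by simp
    then have N1: "1 \<le> N" using ceil(1) unfolding N_def by linarith
    have Nx: "N \<le> a * x"
    proof -
      have "2 * x / ln 2 \<le> 2 * x / (2 / 3)" using x l2 by (intro divide_left_mono) auto
      then have "N \<le> n\<^sub>0 + 3 * x + 1" using ceil(2) by (simp add: N_def)
      moreover have "real n\<^sub>0 * 1 \<le> real n\<^sub>0 * (2 * x)" using x by (intro mult_left_mono) auto
      moreover have "a * x = real n\<^sub>0 * (2 * x) + 5 * x" by (simp add: a_def algebra_simps)
      ultimately show ?thesis using x by linarith
    qed
    have N2: "2 * C * real N ^ k \<le> \<epsilon> * 2 ^ N"
    proof -
      have "exp x \<le> exp (N * (ln 2 / 2))"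
      proof -
        have "2 * x / ln 2 \<le> N" using ceil(1) by (simp add: N_def)
        then show ?thesis using l2 by (simp add: field_simps)
      qed
      also have "\<dots> = sqrt 2 ^ N"
        by (simp add: exp_of_nat_mult ln_sqrt[symmetric])
      finally have "1 / \<epsilon> \<le> sqrt 2 ^ N" using \<epsilon> by (simp add: x_def)
      then have "1 \<le> \<epsilon> * sqrt 2 ^ N" using \<epsilon> by (simp add: field_simps)
      then have "sqrt 2 ^ N * 1 \<le> sqrt 2 ^ N * (\<epsilon> * sqrt 2 ^ N)" by (intro mult_left_mono) auto
      also have "\<dots> = \<epsilon> * 2 ^ N" by (simp add: power_mult_distrib[symmetric])
      finally show ?thesis using n\<^sub>0[of N] by (simp add: N_def)
    qed
    \<comment> \<open>The solution of \<open>2 powr v = K * (x / \<delta>)\<close>, where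
      \<open>K * x\<close> bounds \<open>2 * N + 1\<close>.\<close>
    define v where "v = ln (K * (x / \<delta>)) / ln 2"
    define q where "q = nat \<lceil>v\<rceil>"
    have xd: "0 < x / \<delta>" using x \<delta> by simp
    have v: "v = (ln K + y) / ln 2" unfolding v_def y_def using K xd by (subst ln_mult) auto
    have vpos: "0 < v" unfolding v using \<open>0 < ln K\<close> y y\<^sub>0 l2 by simp
    have q: "v \<le> q" "q \<le> v + 1" "0 < q" unfolding q_def using vpos by linarith+
    have q2: "(2 * real N + 1) * (1 / 2) ^ q \<le> \<delta>"
    proof -
      have "2 * real N + 1 \<le> 2 * (a * x) + 2 * x" using Nx x by simp
      then have "2 * real N + 1 \<le> \<delta> * (K * (x / \<delta>))" using \<delta> by (simp add: K_def algebra_simps)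
      also have "K * (x / \<delta>) = exp (v * ln 2)"
      proof -
        have "v * ln 2 = ln (K * (x / \<delta>))" using l2 by (simp add: v_def)
        moreover have "0 < K * (x / \<delta>)" using K xd by (intro mult_pos_pos) auto
        ultimately show ?thesis by (simp only: exp_ln)
      qed
      also have "\<dots> \<le> exp (q * ln 2)" using q(1) l2 by (simp add: mult_right_mono)
      also have "\<dots> = 2 ^ q" by (simp add: exp_of_nat_mult)
      finally show ?thesis using \<delta> by (simp add: power_one_over field_simps)
    qed
    have qy: "q \<le> b * y"
    proof -
      have "v \<le> (ln K + y) / (1 / 2)"
        unfolding v using \<open>0 < ln K\<close> y y\<^sub>0 l2 by (intro divide_left_mono) auto
      then have "q \<le> (2 * ln K + 1) * 1 + 2 * y" using q(2) by simp
      also have "\<dots> \<le> (2 * ln K + 1) * (y / y\<^sub>0) + 2 * y"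
        using \<open>0 < ln K\<close> y y\<^sub>0 by (intro add_mono mult_left_mono) auto
      finally show ?thesis by (simp add: b_def algebra_simps add_divide_distrib)
    qed
    define X where "X = q * (1 + 12 * C * real N ^ k + N)"
    have X0: "0 \<le> X" using C by (simp add: X_def)
    define n where "n = Suc (nat \<lfloor>X\<rfloor>)"
    have n: "X < n" "n \<le> X + 1" unfolding n_def using X0 by linarith+
    have "n \<le> X + q * 1" using n(2) q(3) by simp
    also have "\<dots> = q * (2 * 1 + 12 * C * real N ^ k + N)" by (simp add: X_def algebra_simps)
    also have "\<dots> \<le> q * (2 * (2 * x) ^ k + 12 * C * (a * x) ^ k + a * (2 * x) ^ k)"
    proof (intro mult_left_mono add_mono)
      show "1 \<le> (2 * x) ^ k" using x by (intro one_le_power) simp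
      show "real N ^ k \<le> (a * x) ^ k" using Nx by (intro power_mono) auto
      \<comment> \<open>The linear term \<open>N\<close> is absorbed into the power, whose base is
        at least 1 and whose exponent is positive.\<close>
      have "x \<le> (2 * x) ^ 1" using x by simp
      also have "\<dots> \<le> (2 * x) ^ k" using x k by (intro power_increasing) auto
      finally show "N \<le> a * (2 * x) ^ k" using Nx a by (meson mult_left_mono order.trans le_numeral_extra(3) zero_le_numeral)
    qed (use C in auto)
    also have "\<dots> \<le> (b * y) * (2 * (2 * x) ^ k + 12 * C * (a * x) ^ k + a * (2 * x) ^ k)"
      using qy C a x by (intro mult_right_mono add_nonneg_nonneg mult_nonneg_nonneg) auto
    also have "\<dots> = c * x ^ k * y"
      by (simp add: c_def power_mult_distrib algebra_simps)
    finally show "\<exists>N q n :: nat. 1 \<le> N \<and> 0 < q \<and> 2 * C * real N ^ k \<le> \<epsilon> * 2 ^ N \<and>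
      (2 * real N + 1) * (1 / 2) ^ q \<le> \<delta> \<and> q * (1 + 12 * C * real N ^ k + N) < n \<and>
      real n \<le> c * ln (1 / \<epsilon>) ^ k * ln (ln (1 / \<epsilon>) / \<delta>)"
      using N1 N2 q(3) q2 n(1) unfolding X_def x_def[symmetric] y_def[symmetric] by blast
  qed
qed

text \<open>The conditional distribution at each instance has all its mass on the target's label,
  hence none on the opposite one. Integration over the instances with a given target label yields
  two null sets, outside of which the label is the target's.\<close>

lemma realizable_imp_separator:
  fixes P :: "((real ^ 'k) \<times> int) measure"
  assumes "prob_space P" and sets_P: "sets P = sets (borel \<Otimes>\<^sub>M label_space)"
    and "realizable linear_separators P"
  obtains \<theta>\<^sub>0 where "realizable_separator P \<theta>\<^sub>0"
proof -
  interpret prob_space P by fact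
  obtain f \<eta> where f: "f \<in> linear_separators" and \<eta>: "conditional_label_distribution P \<eta>"
    and \<eta>f: "\<And>x. measure (\<eta> x) {f x} = 1"
    using assms(3) unfolding realizable_def by blast
  obtain \<theta>\<^sub>0 where \<theta>\<^sub>0: "f = sep \<theta>\<^sub>0" using f by (auto simp: linear_separators_eq)
  have space_P: "space P = UNIV \<times> {-1, 1}"
    using sets_eq_imp_space_eq[OF sets_P] by (simp add: space_pair_measure label_space_def)
  have other: "emeasure (\<eta> x) {- f x} = 0" for x
  proof -
    have "\<eta> x \<in> space (prob_algebra label_space)"
      using \<eta> measurable_space[of \<eta> borel "prob_algebra label_space" x]
      by (simp add: conditional_label_distribution_def)
    then have *: "prob_space (\<eta> x)" "sets (\<eta> x) = sets label_space"
      by (auto simp: space_prob_algebra)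
    interpret L: prob_space "\<eta> x" by fact
    have s: "{f x} \<in> sets (\<eta> x)" "{- f x} \<in> sets (\<eta> x)"
      using sep_values[of \<theta>\<^sub>0 x] by (auto simp: *(2) label_space_def \<theta>\<^sub>0)
    have "f x \<noteq> - f x" using sep_values[of \<theta>\<^sub>0 x] by (auto simp: \<theta>\<^sub>0)
    then have "measure (\<eta> x) ({f x} \<union> {- f x}) = measure (\<eta> x) {f x} + measure (\<eta> x) {- f x}"
      using s by (intro L.finite_measure_Union) auto
    then have "measure (\<eta> x) {- f x} \<le> 0" using L.prob_le_1[of "{f x} \<union> {- f x}"] \<eta>f[of x] by simp
    then show ?thesis by (simp add: L.emeasure_eq_measure measure_le_0_iff)
  qed
  have null: "({x. sep \<theta>\<^sub>0 x = - y} \<times> {y}) \<in> null_sets P" if y: "y \<in> {-1, 1}" for y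
  proof
    have "{x \<in> space borel. sep \<theta>\<^sub>0 x = - y} \<in> sets borel" by measurable
    then have A: "{x. sep \<theta>\<^sub>0 x = - y} \<in> sets borel" by simp
    have B: "{y} \<in> sets label_space" using y by (simp add: label_space_def)
    show "{x. sep \<theta>\<^sub>0 x = - y} \<times> {y} \<in> sets P" unfolding sets_P using A B by (rule pair_measureI)
    have "emeasure P ({x. sep \<theta>\<^sub>0 x = - y} \<times> {y}) = (\<integral>\<^sup>+x\<in>{x. sep \<theta>\<^sub>0 x = - y}. emeasure (\<eta> x) {y} \<partial>distr P borel fst)"
      using \<eta> A B by (auto simp: conditional_label_distribution_def)
    also have "\<dots> = (\<integral>\<^sup>+x. 0 \<partial>distr P borel fst)"
    proof (rule nn_integral_cong)
      fix x
      show "emeasure (\<eta> x) {y} * indicator {x. sep \<theta>\<^sub>0 x = - y} x = 0"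
        using other[of x] by (auto simp: \<theta>\<^sub>0 indicator_def)
    qed
    finally show "emeasure P ({x. sep \<theta>\<^sub>0 x = - y} \<times> {y}) = 0" by simp
  qed
  have "AE z in P. z \<notin> {x. sep \<theta>\<^sub>0 x = - 1} \<times> {1} \<and> z \<notin> {x. sep \<theta>\<^sub>0 x = - (- 1)} \<times> {-1}"
    using null[of 1] null[of "-1"] by (intro AE_conjI AE_not_in) auto
  with AE_space have "AE z in P. snd z = sep \<theta>\<^sub>0 (fst z)"
  proof eventually_elim
    case (elim z)
    then show ?case using sep_values[of \<theta>\<^sub>0 "fst z"] by (cases z) (auto simp: space_P)
  qed
  then have "realizable_separator P \<theta>\<^sub>0" by unfold_locales (rule sets_P)
  then show thesis by (rule that)
qed

theorem corollary12:
  fixes t :: nat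
  assumes "t \<ge> 1"
  shows "\<exists>c::real. c > 0 \<and>
    (\<forall>P :: ((real ^ 'k) \<times> int) measure.
       prob_space P \<longrightarrow>
       sets P = sets (borel \<Otimes>\<^sub>M label_space) \<longrightarrow>
       realizable linear_separators P \<longrightarrow>
       mixture_of t diagonal_normals (distr P borel fst) \<longrightarrow>
       (\<forall>\<epsilon> \<delta>. 0 < \<epsilon> \<and> \<epsilon> \<le> 1 / 2 \<and> 0 < \<delta> \<and> \<delta> \<le> 1 / 2 \<longrightarrow>
          ereal_of_enat (label_complexity linear_separators P \<epsilon> \<delta>)
            \<le> ereal (c * (ln (1 / \<epsilon>)) ^ CARD('k) * ln (ln (1 / \<epsilon>) / \<delta>))))"
proof -
  \<comment> \<open>The constant of \<open>label_complexity_le\<close>; it involves only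
    \<open>t\<close> and the dimension, so \<open>c\<close> can be fixed before
    \<open>P\<close>.\<close>
  let ?C = "2 * real t * 32 ^ CARD('k)"
  obtain c :: real where c: "c > 0" and bound: "\<And>\<epsilon> \<delta> :: real. 0 < \<epsilon> \<Longrightarrow> \<epsilon> \<le> 1 / 2 \<Longrightarrow> 0 < \<delta> \<Longrightarrow> \<delta> \<le> 1 / 2 \<Longrightarrow>
    \<exists>N q n :: nat. 1 \<le> N \<and> 0 < q \<and> 2 * ?C * real N ^ CARD('k) \<le> \<epsilon> * 2 ^ N \<and>
      (2 * real N + 1) * (1 / 2) ^ q \<le> \<delta> \<and> q * (1 + 12 * ?C * real N ^ CARD('k) + N) < n \<and>
      real n \<le> c * ln (1 / \<epsilon>) ^ CARD('k) * ln (ln (1 / \<epsilon>) / \<delta>)"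
    by (rule budget_bound[of ?C "CARD('k)"]) auto
  show ?thesis
  proof (intro exI[of _ c] conjI c allI impI)
    fix P :: "((real ^ 'k) \<times> int) measure" and \<epsilon> \<delta> :: real
    assume P: "prob_space P" "sets P = sets (borel \<Otimes>\<^sub>M label_space)" "realizable linear_separators P"
      and mix: "mixture_of t diagonal_normals (distr P borel fst)"
      and \<epsilon>\<delta>: "0 < \<epsilon> \<and> \<epsilon> \<le> 1 / 2 \<and> 0 < \<delta> \<and> \<delta> \<le> 1 / 2"
    obtain \<theta>\<^sub>0 where "realizable_separator P \<theta>\<^sub>0" by (rule realizable_imp_separator[OF P])
    then interpret realizable_separator P \<theta>\<^sub>0 .
    obtain N q n :: nat where Nqn: "1 \<le> N" "0 < q" "2 * ?C * real N ^ CARD('k) \<le> \<epsilon> * 2 ^ N"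
      "(2 * real N + 1) * (1 / 2) ^ q \<le> \<delta>" "q * (1 + 12 * ?C * real N ^ CARD('k) + N) < n"
      and n: "real n \<le> c * ln (1 / \<epsilon>) ^ CARD('k) * ln (ln (1 / \<epsilon>) / \<delta>)"
      using bound[of \<epsilon> \<delta>] \<epsilon>\<delta> by blast
    have "label_complexity linear_separators P \<epsilon> \<delta> \<le> enat n"
      by (rule label_complexity_le[OF mix Nqn(1,2)]) (use Nqn(3-5) in auto)
    then have "ereal_of_enat (label_complexity linear_separators P \<epsilon> \<delta>) \<le> ereal_of_enat (enat n)"
      by (simp only: ereal_of_enat_le_iff)
    also have "\<dots> = ereal (real n)" by simp
    also have "\<dots> \<le> ereal (c * ln (1 / \<epsilon>) ^ CARD('k) * ln (ln (1 / \<epsilon>) / \<delta>))" using n by simp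
    finally show "ereal_of_enat (label_complexity linear_separators P \<epsilon> \<delta>)
            \<le> ereal (c * (ln (1 / \<epsilon>)) ^ CARD('k) * ln (ln (1 / \<epsilon>) / \<delta>))" .
  qed
qed

end
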